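(* Let $\nu>0$. The transform $\mathcal{I}^\nu$ defined by $\mathcal{I}^\nu F:=Ext(F\circ\psi_2)$, with $\psi_2(\xi)=\left(\frac{\xi}{\sqrt2},\frac{-i\xi}{\sqrt2}\right)$, maps $\mathcal{F}^{2,\nu}(\mathbb{C}^2)$ onto $$\mathcal{F}^{2,\nu}_{slice,i}(\mathbb{H}):=\{F\in\mathcal{F}^{2,\nu}_{slice}(\mathbb{H});\ F(\mathbb{C}_i)\subset\mathbb{C}_i\},$$ and its action on the reproducing kernel $K^\nu_2((u,v),(z,w))$ of $\mathcal{F}^{2,\nu}(\mathbb{C}^2)$ is given by $$\mathcal{I}^\nu\big(K^\nu_2(\cdot,(z,w))\big)(q)=K^\nu_{\mathbb{H}}\left(q,\frac{z+iw}{\sqrt2}\right),\qquad (z,w)\in\mathbb{C}^2,\ q\in\mathbb{H}.$$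
   Context: Let $\nu>0$. Let $\mathbb{H}$ be the quaternions, $\mathbb{S}=\{I\in\mathbb{H}: I^2=-1\}$, and $\mathbb{C}_I=\mathbb{R}+\mathbb{R}I$ for $I\in\mathbb{S}$. Fix $i\in\mathbb{S}$ and identify $\mathbb{C}$ with $\mathbb{C}_i\subset\mathbb{H}$. The Bargmann-Fock space $\mathcal{F}^{2,\nu}(\mathbb{C}^2)$ consists of the holomorphic functions on $\mathbb{C}^2$ that are square integrable with respect to $e^{-\nu(|z|^2+|w|^2)}d\lambda(z,w)$, with $d\lambda$ the Lebesgue measure. Its reproducing kernel is $$K^\nu_2((u,v),(z,w))=\left(\frac{\nu}{\pi}\right)^2e^{\nu(u\overline{z}+v\overline{w})}.$$ Slice regular functions: $F:\mathbb{H}\to\mathbb{H}$ (real differentiable) is (left) slice regular if for every $I\in\mathbb{S}$ its restriction to $\mathbb{C}_I$ satisfies $\left(\frac{\partial}{\partial x}+I\frac{\partial}{\partial y}\right)F(x+yI)=0$. The slice hyperholomorphic Bargmann-Fock space $\mathcal{F}^{2,\nu}_{slice}(\mathbb{H})$ is the right $\mathbb{H}$-vector space of slice regular functions $F$ on $\mathbb{H}$ with $\int_{\mathbb{C}_I}|F(q)|^2e^{-\nu|q|^2}d\lambda_I(q)<\infty$ for some (equivalently, any) $I\in\mathbb{S}$, where $d\lambda_I(x+yI)=dx\,dy$. Its reproducing kernel is $$K^\nu_{\mathbb{H}}(q,p)=\frac{\nu}{\pi}\sum_{m=0}^{\infty}\frac{\nu^m q^m\overline{p}^m}{m!},\qquad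 p,q\in\mathbb{H}.$$ Extension: for a holomorphic $f:\mathbb{C}_i\to\mathbb{C}_i$, $Ext(f)$ is its unique slice regular extension to $\mathbb{H}$: $$Ext(f)(x+yJ)=\tfrac12[f(x+yi)+f(x-yi)]+\tfrac{Ji}{2}[f(x-yi)-f(x+yi)],\qquad x,y\in\mathbb{R},\ J\in\mathbb{S}.$$
   Formalization: The printed kernel identity fails for ν ≠ π (at q = 0 the left side is (ν/π)², the right side ν/π); the formal statement multiplies the right-hand side by the missing factor ν/π. *)

theory Defs
  imports "HOL-Analysis.Analysis"
begin

section \<open>The quaternions\<close>

codatatype quat = Quat (qRe: real) (qIm1: real) (qIm2: real) (qIm3: real)

lemma quat_eq_iff:
  "p = q \<longleftrightarrow> qRe p = qRe q \<and> qIm1 p = qIm1 q \<and> qIm2 p = qIm2 q \<and> qIm3 p = qIm3 q"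
  by (auto intro: quat.expand)

instantiation quat :: ab_group_add
begin

primcorec zero_quat where
  "qRe 0 = 0" | "qIm1 0 = 0" | "qIm2 0 = 0" | "qIm3 0 = 0"

primcorec plus_quat where
  "qRe (p + q) = qRe p + qRe q"
| "qIm1 (p + q) = qIm1 p + qIm1 q"
| "qIm2 (p + q) = qIm2 p + qIm2 q"
| "qIm3 (p + q) = qIm3 p + qIm3 q"

primcorec uminus_quat where
  "qRe (- p) = - qRe p"
| "qIm1 (- p) = - qIm1 p"
| "qIm2 (- p) = - qIm2 p"
| "qIm3 (- p) = - qIm3 p"

primcorec minus_quat where
  "qRe (p - q) = qRe p - qRe q"
| "qIm1 (p - q) = qIm1 p - qIm1 q"
| "qIm2 (p - q) = qIm2 p - qIm2 q"
| "qIm3 (p - q) = qIm3 p - qIm3 q"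

instance
  by standard (simp_all add: quat_eq_iff)

end

instantiation quat :: real_vector
begin

primcorec scaleR_quat where
  "qRe (scaleR r p) = r * qRe p"
| "qIm1 (scaleR r p) = r * qIm1 p"
| "qIm2 (scaleR r p) = r * qIm2 p"
| "qIm3 (scaleR r p) = r * qIm3 p"

instance
  by standard (simp_all add: quat_eq_iff algebra_simps)

end

instantiation quat :: division_ring
begin

primcorec one_quat where
  "qRe 1 = 1" | "qIm1 1 = 0" | "qIm2 1 = 0" | "qIm3 1 = 0"

primcorec times_quat where
  "qRe (p * q) = qRe p * qRe q - qIm1 p * qIm1 q - qIm2 p * qIm2 q - qIm3 p * qIm3 q"
| "qIm1 (p * q) = qRe p * qIm1 q + qIm1 p * qRe q + qIm2 p * qIm3 q - qIm3 p * qIm2 q"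
| "qIm2 (p * q) = qRe p * qIm2 q - qIm1 p * qIm3 q + qIm2 p * qRe q + qIm3 p * qIm1 q"
| "qIm3 (p * q) = qRe p * qIm3 q + qIm1 p * qIm2 q - qIm2 p * qIm1 q + qIm3 p * qRe q"

definition qnorm2 :: "quat \<Rightarrow> real" where
  "qnorm2 p = (qRe p)\<^sup>2 + (qIm1 p)\<^sup>2 + (qIm2 p)\<^sup>2 + (qIm3 p)\<^sup>2"

primcorec inverse_quat where
  "qRe (inverse p) = qRe p / qnorm2 p"
| "qIm1 (inverse p) = - qIm1 p / qnorm2 p"
| "qIm2 (inverse p) = - qIm2 p / qnorm2 p"
| "qIm3 (inverse p) = - qIm3 p / qnorm2 p"

definition divide_quat :: "quat \<Rightarrow> quat \<Rightarrow> quat" where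
  "divide_quat p q = p * inverse q"

lemma qnorm2_eq_0_iff: "qnorm2 p = 0 \<longleftrightarrow> p = 0"
  unfolding qnorm2_def quat_eq_iff
  by (simp add: add_nonneg_eq_0_iff)

instance
proof
  fix a b c :: quat
  show "a * b * c = a * (b * c)" by (simp add: quat_eq_iff algebra_simps)
  show "1 * a = a" "a * 1 = a" by (simp_all add: quat_eq_iff)
  show "(a + b) * c = a * c + b * c" "a * (b + c) = a * b + a * c"
    by (simp_all add: quat_eq_iff algebra_simps)
  show "(0::quat) \<noteq> 1" by (simp add: quat_eq_iff)
  show "a div b = a * inverse b" by (simp add: divide_quat_def)
  show "inverse (0::quat) = 0" by (simp add: quat_eq_iff)
  assume "a \<noteq> 0"
  then have nz: "qnorm2 a \<noteq> 0" by (simp add: qnorm2_eq_0_iff)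
  have *: "qRe a * qRe a / qnorm2 a + qIm1 a * qIm1 a / qnorm2 a
      + qIm2 a * qIm2 a / qnorm2 a + qIm3 a * qIm3 a / qnorm2 a = 1"
    using nz by (simp add: add_divide_distrib[symmetric] qnorm2_def power2_eq_square)
  show "inverse a * a = 1" "a * inverse a = 1"
    using * by (simp_all add: quat_eq_iff algebra_simps)
qed

end

instance quat :: real_algebra_1
  by standard (simp_all add: quat_eq_iff algebra_simps)

instance quat :: real_div_algebra ..

instantiation quat :: real_inner
begin

definition inner_quat :: "quat \<Rightarrow> quat \<Rightarrow> real" where
  "inner_quat p q = qRe p * qRe q + qIm1 p * qIm1 q + qIm2 p * qIm2 q + qIm3 p * qIm3 q"

definition norm_quat :: "quat \<Rightarrow> real" where
  "norm_quat p = sqrt (inner p p)"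

definition sgn_quat :: "quat \<Rightarrow> quat" where
  "sgn_quat p = p /\<^sub>R norm p"

definition dist_quat :: "quat \<Rightarrow> quat \<Rightarrow> real" where
  "dist_quat p q = norm (p - q)"

definition uniformity_quat :: "(quat \<times> quat) filter" where
  "uniformity_quat = (INF e\<in>{0 <..}. principal {(p, q). dist p q < e})"

definition open_quat :: "quat set \<Rightarrow> bool" where
  "open_quat U \<longleftrightarrow> (\<forall>p\<in>U. eventually (\<lambda>(p', q). p' = p \<longrightarrow> q \<in> U) uniformity)"

instance
proof
  fix p q s :: quat and r :: real and U :: "quat set"
  show "dist p q = norm (p - q)" by (rule dist_quat_def)
  show "sgn p = p /\<^sub>R norm p" by (rule sgn_quat_def)
  show "uniformity = (INF e\<in>{0 <..}. principal {(p, q::quat). dist p q < e})"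
    by (rule uniformity_quat_def)
  show "open U \<longleftrightarrow> (\<forall>p\<in>U. eventually (\<lambda>(p', q). p' = p \<longrightarrow> q \<in> U) uniformity)"
    by (rule open_quat_def)
  show "inner p q = inner q p" by (simp add: inner_quat_def mult.commute)
  show "inner (p + q) s = inner p s + inner q s" by (simp add: inner_quat_def algebra_simps)
  show "inner (r *\<^sub>R p) q = r * inner p q" by (simp add: inner_quat_def algebra_simps)
  have nn: "inner p p = qnorm2 p"
    by (simp add: inner_quat_def qnorm2_def power2_eq_square)
  show "0 \<le> inner p p" by (simp add: nn qnorm2_def)
  show "inner p p = 0 \<longleftrightarrow> p = 0" by (simp add: nn qnorm2_eq_0_iff)
  show "norm p = sqrt (inner p p)" by (rule norm_quat_def)
qed

end

instance quat :: real_normed_div_algebra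
proof
  fix p q :: quat
  have "inner (p * q) (p * q) = inner p p * inner q q"
    by (simp add: inner_quat_def algebra_simps)
  then show "norm (p * q) = norm p * norm q"
    by (simp add: norm_quat_def real_sqrt_mult)
qed

instantiation quat :: euclidean_space
begin

definition Basis_quat :: "quat set" where
  "Basis_quat = {Quat 1 0 0 0, Quat 0 1 0 0, Quat 0 0 1 0, Quat 0 0 0 1}"

instance
proof
  show "(Basis :: quat set) \<noteq> {}" "finite (Basis :: quat set)"
    by (simp_all add: Basis_quat_def)
  show "inner u v = (if u = v then 1 else 0)" if "u \<in> Basis" "v \<in> Basis" for u v :: quat
    using that unfolding Basis_quat_def
    by (elim insertE emptyE) (simp_all add: inner_quat_def)
  show "(\<forall>u\<in>Basis. inner p u = 0) \<longleftrightarrow> p = 0" for p :: quat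
    unfolding Basis_quat_def by (simp add: inner_quat_def) (simp add: quat_eq_iff)
qed

end

primcorec qcnj :: "quat \<Rightarrow> quat" where
  "qRe (qcnj q) = qRe q"
| "qIm1 (qcnj q) = - qIm1 q"
| "qIm2 (qcnj q) = - qIm2 q"
| "qIm3 (qcnj q) = - qIm3 q"

definition qVec :: "quat \<Rightarrow> quat" where
  "qVec q = q - of_real (qRe q)"


section \<open>Slices\<close>

definition imag_units :: "quat set" where
  "imag_units = {I. I\<^sup>2 = -1}"

text \<open>The algebra embedding of \<^typ>\<open>complex\<close> into \<^typ>\<open>quat\<close> with image \<open>\<real> + \<real>I\<close>; for the
  distinguished unit \<open>i\<close>, it is the identification of \<open>\<complex>\<close> with \<open>\<complex>\<^sub>i\<close>.\<close>

definition emb :: "quat \<Rightarrow> complex \<Rightarrow> quat" where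
  "emb I z = of_real (Re z) + of_real (Im z) * I"

definition slice :: "quat \<Rightarrow> quat set" where
  "slice I = {of_real x + of_real y * I | x y. True}"

definition slice_regular :: "(quat \<Rightarrow> quat) \<Rightarrow> bool" where
  "slice_regular F \<longleftrightarrow>
     (\<forall>q. F differentiable (at q)) \<and>
     (\<forall>I\<in>imag_units. \<forall>x y.
        vector_derivative (\<lambda>t. F (of_real t + of_real y * I)) (at x)
        + I * vector_derivative (\<lambda>t. F (of_real x + of_real t * I)) (at y) = 0)"

text \<open>The measure \<open>d\<lambda>\<^sub>I(x + yI) = dx dy\<close> is written as Lebesgue measure on the
  parameter \<open>z = x + \<i>y\<close> of \<^term>\<open>emb I z\<close>.\<close>

definition fock_slice :: "real \<Rightarrow> (quat \<Rightarrow> quat) set" where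
  "fock_slice \<nu> =
     {F. slice_regular F \<and>
         (\<exists>I\<in>imag_units.
            integrable lborel (\<lambda>z. (norm (F (emb I z)))\<^sup>2 * exp (- \<nu> * (norm (emb I z))\<^sup>2)))}"

definition fock_slice_preserving :: "quat \<Rightarrow> real \<Rightarrow> (quat \<Rightarrow> quat) set" where
  "fock_slice_preserving i \<nu> = {F \<in> fock_slice \<nu>. F ` slice i \<subseteq> slice i}"

definition kernel_quat :: "real \<Rightarrow> quat \<Rightarrow> quat \<Rightarrow> quat" where
  "kernel_quat \<nu> q p = (\<nu> / pi) *\<^sub>R (\<Sum>m. (\<nu> ^ m / fact m) *\<^sub>R (q ^ m * qcnj p ^ m))"


section \<open>The Bargmann-Fock space on \<open>\<complex>\<^sup>2\<close>\<close>

text \<open>Holomorphy in two variables: real differentiability with complex linear derivative.\<close>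

definition holomorphic2 :: "(complex \<times> complex \<Rightarrow> complex) \<Rightarrow> bool" where
  "holomorphic2 F \<longleftrightarrow>
     (\<forall>p. \<exists>a b. (F has_derivative (\<lambda>h. a * fst h + b * snd h)) (at p))"

definition fock2 :: "real \<Rightarrow> (complex \<times> complex \<Rightarrow> complex) set" where
  "fock2 \<nu> =
     {F. holomorphic2 F \<and>
         integrable lborel
           (\<lambda>(z, w). (norm (F (z, w)))\<^sup>2 * exp (- \<nu> * ((norm z)\<^sup>2 + (norm w)\<^sup>2)))}"

definition kernel2 :: "real \<Rightarrow> complex \<times> complex \<Rightarrow> complex \<times> complex \<Rightarrow> complex" where
  "kernel2 \<nu> = (\<lambda>(u, v) (z, w).
     of_real ((\<nu> / pi)\<^sup>2) * exp (of_real \<nu> * (u * cnj z + v * cnj w)))"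


section \<open>Slice extension and the transform\<close>

text \<open>Every \<open>q\<close> is \<open>x + yJ\<close> with \<open>x = Re q\<close>, \<open>y = |Vec q|\<close> and \<open>J\<close> the direction of \<open>Vec q\<close>
  (any unit, here \<open>i\<close>, if \<open>q\<close> is real). The lemma \<open>Ext_formula\<close> shows that the value does not
  depend on the chosen representation.\<close>

definition Ext :: "quat \<Rightarrow> (complex \<Rightarrow> complex) \<Rightarrow> quat \<Rightarrow> quat" where
  "Ext i f q =
     (let x = qRe q;
          y = norm (qVec q);
          J = (if qVec q = 0 then i else qVec q /\<^sub>R y);
          fp = emb i (f (Complex x y));
          fm = emb i (f (Complex x (- y)))
      in (1/2) *\<^sub>R (fp + fm) + (1/2) *\<^sub>R (J * i * (fm - fp)))"

lemma imag_units_iff: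
  "J \<in> imag_units \<longleftrightarrow> qRe J = 0 \<and> (qIm1 J)\<^sup>2 + (qIm2 J)\<^sup>2 + (qIm3 J)\<^sup>2 = 1"
proof
  assume "J \<in> imag_units"
  then have e: "qRe J * qRe J - qIm1 J * qIm1 J - qIm2 J * qIm2 J - qIm3 J * qIm3 J = -1"
    "qRe J * qIm1 J = 0" "qRe J * qIm2 J = 0" "qRe J * qIm3 J = 0"
    by (auto simp: imag_units_def power2_eq_square quat_eq_iff algebra_simps)
  have "qRe J = 0"
  proof (rule ccontr)
    assume "qRe J \<noteq> 0"
    then have "qRe J * qRe J = -1" using e by simp
    then show False using zero_le_square[of "qRe J"] by linarith
  qed
  then show "qRe J = 0 \<and> (qIm1 J)\<^sup>2 + (qIm2 J)\<^sup>2 + (qIm3 J)\<^sup>2 = 1"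
    using e by (simp add: power2_eq_square)
next
  assume "qRe J = 0 \<and> (qIm1 J)\<^sup>2 + (qIm2 J)\<^sup>2 + (qIm3 J)\<^sup>2 = 1"
  then show "J \<in> imag_units"
    by (simp add: imag_units_def power2_eq_square quat_eq_iff algebra_simps)
qed

lemma of_real_quat_sel [simp]:
  "qRe (of_real r) = r" "qIm1 (of_real r) = 0" "qIm2 (of_real r) = 0" "qIm3 (of_real r) = 0"
  by (simp_all add: of_real_def)

lemma Ext_formula:
  assumes "J \<in> imag_units"
  shows "Ext i f (of_real x + of_real y * J) =
    (1/2) *\<^sub>R (emb i (f (Complex x y)) + emb i (f (Complex x (- y))))
    + (1/2) *\<^sub>R (J * i * (emb i (f (Complex x (- y))) - emb i (f (Complex x y))))"
proof -
  have J: "qRe J = 0" "(qIm1 J)\<^sup>2 + (qIm2 J)\<^sup>2 + (qIm3 J)\<^sup>2 = 1"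
    using assms by (auto simp: imag_units_iff)
  have "norm J = 1"
    using J by (simp add: norm_quat_def inner_quat_def power2_eq_square)
  let ?q = "of_real x + of_real y * J"
  have re: "qRe ?q = x" by (simp add: J)
  have vec: "qVec ?q = y *\<^sub>R J"
    by (simp add: qVec_def quat_eq_iff J)
  have n: "norm (qVec ?q) = \<bar>y\<bar>" using \<open>norm J = 1\<close> vec by simp
  have J0: "J \<noteq> 0" using \<open>norm J = 1\<close> by auto
  consider "y = 0" | "y > 0" | "y < 0" by linarith
  then show ?thesis
  proof cases
    case 1 then show ?thesis using re vec n by (simp add: Ext_def Let_def)
  next
    case 2 then show ?thesis using re vec n J0 by (simp add: Ext_def Let_def)
  next
    case 3 then show ?thesis using re vec n J0
      by (simp add: Ext_def Let_def algebra_simps)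
  qed
qed

lemma kernel_quat_summable:
  "summable (\<lambda>m. (\<nu> ^ m / fact m) *\<^sub>R (q ^ m * qcnj p ^ m))"
proof (rule summable_comparison_test')
  let ?c = "\<bar>\<nu>\<bar> * norm q * norm (qcnj p)"
  show "summable (\<lambda>m. inverse (fact m) * ?c ^ m)" by (rule summable_exp)
  show "norm ((\<nu> ^ m / fact m) *\<^sub>R (q ^ m * qcnj p ^ m)) \<le> inverse (fact m) * ?c ^ m" for m
    by (simp add: norm_mult norm_power power_mult_distrib power_abs abs_mult divide_inverse)
qed

definition psi2 :: "complex \<Rightarrow> complex \<times> complex" where
  "psi2 \<xi> = (\<xi> / of_real (sqrt 2), - \<i> * \<xi> / of_real (sqrt 2))"

definition slice_transform :: "quat \<Rightarrow> (complex \<times> complex \<Rightarrow> complex) \<Rightarrow> quat \<Rightarrow> quat" where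
  "slice_transform i F = Ext i (F \<circ> psi2)"

text \<open>The constants \<open>(\<nu>/\<pi>)\<^sup>2\<close> in \<^const>\<open>kernel2\<close> and \<open>\<nu>/\<pi>\<close> in \<^const>\<open>kernel_quat\<close> are those of
  the unnormalised Gaussian weights, so \<^const>\<open>slice_transform\<close> sends the former kernel to
  \<open>\<nu>/\<pi>\<close> times the latter; at \<open>q = 0\<close> the two values are \<open>(\<nu>/\<pi>)\<^sup>2\<close> and \<open>\<nu>/\<pi>\<close>.\<close>

end

theory Submission
  imports Defs "HOL-Complex_Analysis.Complex_Analysis" "HOL-Probability.Distributions"
begin

text \<open>
  An entire function \<open>f = \<Sum> a\<^sub>n z\<^sup>n\<close>, such as \<open>F \<circ> \<psi>\<^sub>2\<close>, has the extension \<open>\<Sum> q\<^sup>n a\<^sub>n\<close>, which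
  is slice regular and whose expansion for exponential \<open>f\<close> is the quaternionic kernel.
  Restriction to the range of \<open>\<psi>\<^sub>2\<close> preserves square integrability because point evaluation is
  bounded on the one-variable Fock space; a right inverse of the restriction is
  \<open>F(z, w) = f((z + \<i> w)/\<surd>2)\<close>. Conversely, a slice regular \<open>G\<close> preserving \<open>\<complex>\<^sub>i\<close> agrees with the
  extension of its restriction by the identity theorem: composing with \<open>\<complex>\<^sub>I\<close>-linear functionals
  \<open>q \<mapsto> \<langle>q, a\<rangle> - \<i> \<langle>I q, a\<rangle>\<close> turns slice regularity into ordinary holomorphy. That the integrability
  condition does not depend on the slice is the parallelogram law.
\<close>

section \<open>Integration over \<open>\<complex>\<close> and point evaluation in Fock spaces\<close>

lemma borel_measurable_Complex [measurable (raw)]: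
  assumes [measurable]: "f \<in> borel_measurable M" "g \<in> borel_measurable M"
  shows "(\<lambda>x. Complex (f x) (g x)) \<in> borel_measurable M"
  unfolding Complex_eq by measurable

text \<open>Lebesgue measure is determined by its values on boxes, and a box in the plane pulls back
  to a product of two open intervals.\<close>

lemma lborel_complex_eq:
  "(lborel :: complex measure) = distr (lborel \<Otimes>\<^sub>M lborel) borel (\<lambda>(x, y). Complex x y)"
proof (rule lborel_eqI)
  fix l u :: complex
  assume "\<And>b. b \<in> Basis \<Longrightarrow> l \<bullet> b \<le> u \<bullet> b"
  from this[of 1] this[of \<i>] have le: "Re l \<le> Re u" "Im l \<le> Im u"
    by (auto simp: Basis_complex_def)
  have "(\<lambda>(x, y). Complex x y) -` box l u = {Re l<..<Re u} \<times> {Im l<..<Im u}"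
    by (auto simp: box_def Basis_complex_def)
  then show "emeasure (distr (lborel \<Otimes>\<^sub>M lborel) borel (\<lambda>(x, y). Complex x y)) (box l u)
    = (\<Prod>b\<in>Basis. (u - l) \<bullet> b)"
    using le by (simp add: emeasure_distr space_pair_measure lborel.emeasure_pair_measure_Times
        Basis_complex_def ennreal_mult' complex_eq_iff)
qed simp

lemma nn_integral_complex_iterated:
  assumes [measurable]: "g \<in> borel_measurable (borel :: complex measure)"
  shows "(\<integral>\<^sup>+z. g z \<partial>lborel) = (\<integral>\<^sup>+x. \<integral>\<^sup>+y. g (Complex x y) \<partial>lborel \<partial>lborel)"
proof -
  have "(\<integral>\<^sup>+z. g z \<partial>lborel) = (\<integral>\<^sup>+p. g (case p of (x, y) \<Rightarrow> Complex x y) \<partial>(lborel \<Otimes>\<^sub>M lborel))"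
    by (subst lborel_complex_eq) (simp add: nn_integral_distr)
  also have "\<dots> = (\<integral>\<^sup>+x. \<integral>\<^sup>+y. g (Complex x y) \<partial>lborel \<partial>lborel)"
    by (subst lborel.nn_integral_fst[symmetric]) auto
  finally show ?thesis .
qed

text \<open>This is Tonelli for nonnegative integrands. It turns the norm condition of the
  two-variable Fock space into an iterated integral that can be estimated one variable at a
  time.\<close>

lemma integrable_lborel_prod_iff:
  fixes k :: "'a::euclidean_space \<times> 'b::euclidean_space \<Rightarrow> real"
  assumes [measurable]: "k \<in> borel_measurable (borel \<Otimes>\<^sub>M borel)" and nonneg: "\<And>p. 0 \<le> k p"
  shows "integrable lborel k \<longleftrightarrow> (\<integral>\<^sup>+x. \<integral>\<^sup>+y. ennreal (k (x, y)) \<partial>lborel \<partial>lborel) < \<infinity>"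
proof -
  have "integrable lborel k \<longleftrightarrow> integrable (lborel \<Otimes>\<^sub>M lborel) k"
    by (simp only: lborel_prod)
  also have "\<dots> \<longleftrightarrow> (\<integral>\<^sup>+p. ennreal (k p) \<partial>(lborel \<Otimes>\<^sub>M lborel)) < \<infinity>"
    using nonneg by (simp add: integrable_iff_bounded)
  also have "(\<integral>\<^sup>+p. ennreal (k p) \<partial>(lborel \<Otimes>\<^sub>M lborel))
      = (\<integral>\<^sup>+x. \<integral>\<^sup>+y. ennreal (k (x, y)) \<partial>lborel \<partial>lborel)"
    by (rule lborel.nn_integral_fst[symmetric]) measurable
  finally show ?thesis .
qed

lemma nn_integral_complex_cnj:
  assumes [measurable]: "g \<in> borel_measurable (borel :: complex measure)"
  shows "(\<integral>\<^sup>+z. g (cnj z) \<partial>lborel) = (\<integral>\<^sup>+z. g z \<partial>lborel)"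
proof -
  have [measurable]: "cnj \<in> borel \<rightarrow>\<^sub>M borel"
    by (intro borel_measurable_continuous_onI continuous_intros)
  have "(\<integral>\<^sup>+y. g (Complex x (- y)) \<partial>lborel) = (\<integral>\<^sup>+y. g (Complex x y) \<partial>lborel)" for x
    using nn_integral_real_affine[of "\<lambda>y. g (Complex x y)" "-1" 0] by simp
  then show ?thesis
    by (simp add: nn_integral_complex_iterated complex_cnj)
qed

text \<open>The rotation is undone by two one-dimensional affine substitutions, first in
  \<open>x\<close> with \<open>y\<close> fixed, then in \<open>y\<close> with \<open>x\<close>
  fixed. The first one divides by \<open>Re c\<close>, whence the hypothesis.\<close>

lemma nn_integral_complex_mult_unit_Re_nonzero:
  assumes [measurable]: "g \<in> borel_measurable (borel :: complex measure)"
    and c: "norm c = 1" "Re c \<noteq> 0"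
  shows "(\<integral>\<^sup>+z. g (c * z) \<partial>lborel) = (\<integral>\<^sup>+z. g z \<partial>lborel)"
proof -
  define a b where "a = Re c" and "b = Im c"
  have ab: "a\<^sup>2 + b\<^sup>2 = 1" "a \<noteq> 0"
    using c by (auto simp: a_def b_def cmod_def)
  then have ab': "a * a + b * b = 1" by (simp add: power2_eq_square)
  have "(\<integral>\<^sup>+z. g (c * z) \<partial>lborel)
      = (\<integral>\<^sup>+x. \<integral>\<^sup>+y. g (Complex (a * x - b * y) (a * y + b * x)) \<partial>lborel \<partial>lborel)"
    by (simp add: nn_integral_complex_iterated complex_mult a_def b_def)
       (simp add: times_complex.ctr)
  also have "\<dots> = (\<integral>\<^sup>+y. \<integral>\<^sup>+x. g (Complex (a * x - b * y) (a * y + b * x)) \<partial>lborel \<partial>lborel)"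
    by (rule lborel_pair.Fubini') (simp add: case_prod_unfold)
  \<comment> \<open>The substitution replaces \<open>x\<close> by \<open>(b * y + x) / a\<close>.
    The second coordinate then simplifies because \<open>a * a + b * b = 1\<close>.\<close>
  also have "\<dots> = (\<integral>\<^sup>+y. \<bar>1 / a\<bar> * (\<integral>\<^sup>+x. g (Complex x (y / a + b * x / a)) \<partial>lborel) \<partial>lborel)"
  proof (rule nn_integral_cong)
    fix y
    have "a * y + b * ((b * y + x) / a) = y / a + b * x / a" for x
    proof -
      have "a * y + b * ((b * y + x) / a) = ((a * a + b * b) * y + b * x) / a"
        using ab by (simp add: field_simps)
      then show ?thesis using ab' by (simp add: add_divide_distrib)
    qed
    then show "(\<integral>\<^sup>+x. g (Complex (a * x - b * y) (a * y + b * x)) \<partial>lborel)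
      = \<bar>1 / a\<bar> * (\<integral>\<^sup>+x. g (Complex x (y / a + b * x / a)) \<partial>lborel)"
      using nn_integral_real_affine[of "\<lambda>x. g (Complex (a * x - b * y) (a * y + b * x))" "1 / a" "b * y / a"]
        ab by (simp add: add_divide_distrib[symmetric])
  qed
  also have "\<dots> = \<bar>1 / a\<bar> * (\<integral>\<^sup>+y. \<integral>\<^sup>+x. g (Complex x (y / a + b * x / a)) \<partial>lborel \<partial>lborel)"
    by (rule nn_integral_cmult) measurable
  also have "(\<integral>\<^sup>+y. \<integral>\<^sup>+x. g (Complex x (y / a + b * x / a)) \<partial>lborel \<partial>lborel)
      = (\<integral>\<^sup>+x. \<integral>\<^sup>+y. g (Complex x (y / a + b * x / a)) \<partial>lborel \<partial>lborel)"
    by (rule lborel_pair.Fubini'[symmetric]) (simp add: case_prod_unfold)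
  \<comment> \<open>Replacing \<open>y\<close> by \<open>a * y - b * x\<close> straightens the
    second coordinate, and its Jacobian cancels the earlier one.\<close>
  also have "\<dots> = (\<integral>\<^sup>+x. \<bar>a\<bar> * (\<integral>\<^sup>+y. g (Complex x y) \<partial>lborel) \<partial>lborel)"
  proof (rule nn_integral_cong)
    fix x
    have "(a * y - b * x) / a + b * x / a = y" for y
      using ab by (simp add: field_simps)
    then show "(\<integral>\<^sup>+y. g (Complex x (y / a + b * x / a)) \<partial>lborel) = \<bar>a\<bar> * (\<integral>\<^sup>+y. g (Complex x y) \<partial>lborel)"
      using nn_integral_real_affine[of "\<lambda>y. g (Complex x (y / a + b * x / a))" a "- b * x"] ab
      by (simp add: algebra_simps)
  qed
  also have "\<dots> = \<bar>a\<bar> * (\<integral>\<^sup>+z. g z \<partial>lborel)"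
    by (subst nn_integral_cmult) (auto simp: nn_integral_complex_iterated)
  also have "\<bar>1 / a\<bar> * (\<bar>a\<bar> * (\<integral>\<^sup>+z. g z \<partial>lborel)) = (\<integral>\<^sup>+z. g z \<partial>lborel)"
    using ab by (simp add: mult.assoc[symmetric] ennreal_mult'[symmetric])
  finally show ?thesis .
qed


lemma nn_integral_complex_mult_unit:
  assumes [measurable]: "g \<in> borel_measurable (borel :: complex measure)"
    and c: "norm c = 1"
  shows "(\<integral>\<^sup>+z. g (c * z) \<partial>lborel) = (\<integral>\<^sup>+z. g z \<partial>lborel)"
proof (cases "Re c = 0")
  case False
  then show ?thesis using nn_integral_complex_mult_unit_Re_nonzero c by simp
next
  case True
  \<comment> \<open>A rotation by a right angle is a composition of two rotations by half of it.\<close>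
  define d where "d = cis (pi / 4)"
  have d: "norm d = 1" "Re d \<noteq> 0" "d * cnj d = 1"
    by (simp_all add: d_def cos_45 cis_mult cis_cnj)
  have "Im c \<noteq> 0" using True c by (auto simp: cmod_def)
  \<comment> \<open>Since \<open>Re c = 0\<close>, the real part of \<open>c * cnj d\<close> is
    \<open>Im c * sin (pi / 4)\<close>.\<close>
  then have cd: "norm (c * cnj d) = 1" "Re (c * cnj d) \<noteq> 0"
    using True c d(1) by (simp_all add: norm_mult) (simp add: d_def sin_45)
  have "(\<integral>\<^sup>+z. g (c * z) \<partial>lborel) = (\<integral>\<^sup>+z. g ((c * cnj d) * (d * z)) \<partial>lborel)"
    using d(3) by (simp add: mult.assoc mult.left_commute[of "cnj d"]) (simp add: mult.assoc[symmetric])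
  also have "\<dots> = (\<integral>\<^sup>+z. g ((c * cnj d) * z) \<partial>lborel)"
    by (rule nn_integral_complex_mult_unit_Re_nonzero[OF _ d(1,2)]) measurable
  also have "\<dots> = (\<integral>\<^sup>+z. g z \<partial>lborel)"
    by (rule nn_integral_complex_mult_unit_Re_nonzero[OF _ cd]) measurable
  finally show ?thesis .
qed

section \<open>Gaussian integrals, mean values of entire functions and point evaluation\<close>

lemma nn_integral_lborel_affine:
  fixes g :: "'a::euclidean_space \<Rightarrow> ennreal"
  assumes [measurable]: "g \<in> borel_measurable borel" and c: "c \<noteq> 0"
  shows "(\<integral>\<^sup>+x. g x \<partial>lborel) = ennreal (\<bar>c\<bar> ^ DIM('a)) * (\<integral>\<^sup>+x. g (t + c *\<^sub>R x) \<partial>lborel)"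
  by (subst lborel_affine[OF c, of t])
     (simp add: nn_integral_density nn_integral_distr nn_integral_cmult)

text \<open>For positive \<open>\<nu>\<close> the value is \<open>pi / \<nu>\<close>. Taking it in
  \<open>ennreal\<close> lets the evaluation bound below hold for every real
  \<open>\<nu>\<close>.\<close>

definition gauss_mass :: "real \<Rightarrow> ennreal" where
  "gauss_mass \<nu> = (\<integral>\<^sup>+(z::complex). ennreal (exp (- \<nu> * (norm z)\<^sup>2)) \<partial>lborel)"

lemma gauss_mass_finite:
  assumes "\<nu> > 0"
  shows "gauss_mass \<nu> < \<infinity>"
proof -
  \<comment> \<open>The standard deviation for which the exponent of the normal density is
    \<open>- \<nu> * x\<^sup>2\<close>.\<close>
  define \<sigma> where "\<sigma> = 1 / sqrt (2 * \<nu>)"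
  have "\<sigma> > 0" and s: "\<sigma>\<^sup>2 = 1 / (2 * \<nu>)"
    using assms by (simp_all add: \<sigma>_def power_divide)
  have "normal_density 0 \<sigma> = (\<lambda>x. 1 / sqrt (2 * pi * \<sigma>\<^sup>2) * exp (- \<nu> * x\<^sup>2))"
    by (simp add: normal_density_def s fun_eq_iff mult.commute)
  then have "integrable lborel (\<lambda>x. 1 / sqrt (2 * pi * \<sigma>\<^sup>2) * exp (- \<nu> * x\<^sup>2))"
    by (metis integrable_normal_density \<open>\<sigma> > 0\<close>)
  then have "integrable lborel (\<lambda>x. exp (- \<nu> * x\<^sup>2))"
    using \<open>\<sigma> > 0\<close> by (subst (asm) integrable_mult_left_iff) auto
  then have fin: "(\<integral>\<^sup>+x. ennreal (exp (- \<nu> * x\<^sup>2)) \<partial>lborel) < \<infinity>"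
    by (simp add: integrable_iff_bounded)
  have "gauss_mass \<nu> = (\<integral>\<^sup>+(z::complex). (\<Prod>b\<in>Basis. ennreal (exp (- \<nu> * (z \<bullet> b)\<^sup>2))) \<partial>lborel)"
    by (simp add: gauss_mass_def Basis_complex_def ennreal_mult'[symmetric] exp_add[symmetric]
        cmod_power2 algebra_simps complex_eq_iff)
  also have "\<dots> = (\<Prod>b\<in>(Basis::complex set). (\<integral>\<^sup>+x. ennreal (exp (- \<nu> * x\<^sup>2)) \<partial>lborel))"
    by (rule nn_integral_lborel_prod) auto
  also have "\<dots> < \<infinity>"
    using fin by (simp add: power_less_top_ennreal)
  finally show ?thesis .
qed

lemma gauss_mass_pos: "gauss_mass \<nu> > 0"
proof -
  have "\<not> (AE z::complex in lborel. ennreal (exp (- \<nu> * (norm z)\<^sup>2)) = 0)"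
    using ae_filter_eq_bot_iff[of "lborel :: complex measure"]
    by (simp add: ennreal_eq_0_iff not_le eventually_False)
  then show ?thesis
    unfolding gauss_mass_def zero_less_iff_neq_zero by (subst nn_integral_0_iff_AE) auto
qed

text \<open>Cauchy's formula on the unit circle for the function sending \<open>u\<close> to
  \<open>h (p * u)\<close>. Scaling the argument instead of the circle covers \<open>p = 0\<close>
  without a separate case.\<close>

lemma entire_circle_mean:
  assumes h: "h holomorphic_on UNIV"
  shows "((\<lambda>t. h (p * exp (2 * of_real pi * \<i> * of_real t))) has_integral h 0) {0..1}"
proof -
  have "(\<lambda>u. h (p * u)) holomorphic_on UNIV"
    by (rule holomorphic_on_compose[OF _ holomorphic_on_subset[OF h], unfolded o_def])
       (auto intro!: holomorphic_intros)
  then have "((\<lambda>u. h (p * u) / (u - 0)) has_contour_integral (2 * of_real pi * \<i> * h (p * 0)))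
     (circlepath 0 1)"
    by (intro Cauchy_integral_circlepath_simple) (auto intro: holomorphic_on_subset)
  then have "((\<lambda>t. 2 * of_real pi * \<i> * h (p * exp (2 * of_real pi * \<i> * of_real t)))
      has_integral (2 * of_real pi * \<i> * h 0)) {0..1}"
    unfolding has_contour_integral vector_derivative_circlepath
    by (simp add: circlepath mult_ac)
  from has_integral_mult_right[OF this, of "1 / (2 * of_real pi * \<i>)"] show ?thesis
    by (simp add: field_simps)
qed

text \<open>The mean value property with norms taken inside, moved from the gauge integral to the
  nonnegative Lebesgue integral so that Tonelli can be applied to it.\<close>

lemma entire_norm_le_circle_mean:
  assumes h: "h holomorphic_on UNIV"
  shows "ennreal (norm (h 0)) \<le>
    (\<integral>\<^sup>+t. ennreal (norm (h (p * exp (2 * of_real pi * \<i> * of_real t)))) * indicator {0..1} t \<partial>lborel)"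
proof -
  let ?k = "\<lambda>t. h (p * exp (2 * of_real pi * \<i> * of_real t))"
  have ch: "continuous_on S h" for S
    using h holomorphic_on_imp_continuous_on continuous_on_subset by blast
  have ck: "continuous_on S ?k" for S
    by (intro continuous_on_compose2[OF ch[of UNIV]] continuous_intros) auto
  have int: "(\<lambda>t. norm (?k t)) integrable_on {0..1}"
    by (intro integrable_continuous_interval continuous_intros ck)
  have "norm (integral {0..1} ?k) \<le> integral {0..1} (\<lambda>t. norm (?k t))"
    using entire_circle_mean[OF h, of p] int
    by (intro integral_norm_bound_integral) (auto simp: has_integral_integrable)
  then have "norm (h 0) \<le> integral {0..1} (\<lambda>t. norm (?k t))"
    using entire_circle_mean[OF h, of p] by (simp add: integral_unique)
  moreover have "((\<lambda>t. norm (?k t) * indicator {0..1} t) has_integral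
      integral {0..1} (\<lambda>t. norm (?k t))) UNIV"
    using integrable_integral[OF int]
    by (subst (asm) has_integral_restrict_UNIV[symmetric])
       (simp add: indicator_def of_bool_def if_distrib[of "\<lambda>x. _ * x"] cong: if_cong)
  then have "(\<integral>\<^sup>+t. ennreal (norm (?k t) * indicator {0..1} t) \<partial>lborel)
      = ennreal (integral {0..1} (\<lambda>t. norm (?k t)))"
    using ck[of UNIV]
    by (intro nn_integral_has_integral_lborel borel_measurable_times borel_measurable_indicator
        borel_measurable_continuous_onI[OF continuous_on_norm]) auto
  moreover have "ennreal (norm (?k t) * indicator {0..1} t) = ennreal (norm (?k t)) * indicator {0..1} t" for t
    by (simp add: indicator_def)
  ultimately show ?thesis by (simp add: ennreal_leI)
qed

text \<open>The circle inequality through each \<open>p\<close> is weighted by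
  \<open>W (norm p)\<close> and integrated over the plane. After exchanging the integrals, rotation
  invariance makes the integral over \<open>p\<close> independent of the angle.\<close>

lemma entire_norm_le_radial_mean:
  assumes h: "h holomorphic_on UNIV" and [measurable]: "W \<in> borel_measurable borel"
  shows "ennreal (norm (h 0)) * (\<integral>\<^sup>+(p::complex). W (norm p) \<partial>lborel)
    \<le> (\<integral>\<^sup>+p. ennreal (norm (h p)) * W (norm p) \<partial>lborel)"
proof -
  let ?e = "\<lambda>t::real. exp (2 * of_real pi * \<i> * of_real t)"
  have ch: "continuous_on UNIV h"
    using h holomorphic_on_imp_continuous_on by blast
  then have [measurable]: "h \<in> borel_measurable borel"
    by (rule borel_measurable_continuous_onI)
  have [measurable]: "?e \<in> borel_measurable borel"
    by (intro borel_measurable_continuous_onI continuous_intros)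
  have ne: "norm (?e t) = 1" for t
    by simp
  have "ennreal (norm (h 0)) * (\<integral>\<^sup>+(p::complex). W (norm p) \<partial>lborel)
      = (\<integral>\<^sup>+(p::complex). ennreal (norm (h 0)) * W (norm p) \<partial>lborel)"
    by (subst nn_integral_cmult) auto
  also have "\<dots> \<le> (\<integral>\<^sup>+p. (\<integral>\<^sup>+t. ennreal (norm (h (p * ?e t))) * indicator {0..1} t \<partial>lborel) * W (norm p) \<partial>lborel)"
    by (intro nn_integral_mono mult_right_mono entire_norm_le_circle_mean[OF h]) simp
  also have "\<dots> = (\<integral>\<^sup>+p. (\<integral>\<^sup>+t. ennreal (norm (h (p * ?e t))) * indicator {0..1} t * W (norm p) \<partial>lborel) \<partial>lborel)"
    by (intro nn_integral_cong nn_integral_multc[symmetric]) measurable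
  also have "\<dots> = (\<integral>\<^sup>+t. (\<integral>\<^sup>+p. ennreal (norm (h (p * ?e t))) * indicator {0..1} t * W (norm p) \<partial>lborel) \<partial>lborel)"
    by (rule lborel_pair.Fubini') measurable
  also have "\<dots> = (\<integral>\<^sup>+t. (\<integral>\<^sup>+p. ennreal (norm (h p)) * W (norm p) \<partial>lborel) * indicator {0..1::real} t \<partial>lborel)"
  proof (rule nn_integral_cong)
    fix t :: real
    have "(\<integral>\<^sup>+p. ennreal (norm (h (p * ?e t))) * indicator {0..1} t * W (norm p) \<partial>lborel)
       = (\<integral>\<^sup>+p. ennreal (norm (h (?e t * p))) * W (norm (?e t * p)) * indicator {0..1} t \<partial>lborel)"
      unfolding norm_mult ne by (simp add: mult_ac)
    also have "\<dots> = (\<integral>\<^sup>+p. ennreal (norm (h p)) * W (norm p) * indicator {0..1} t \<partial>lborel)"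
      by (rule nn_integral_complex_mult_unit[OF _ ne,
            where g = "\<lambda>p. ennreal (norm (h p)) * W (norm p) * indicator {0..1} t"]) measurable
    also have "\<dots> = (\<integral>\<^sup>+p. ennreal (norm (h p)) * W (norm p) \<partial>lborel) * indicator {0..1} t"
      by (rule nn_integral_multc) measurable
    finally show "(\<integral>\<^sup>+p. ennreal (norm (h (p * ?e t))) * indicator {0..1} t * W (norm p) \<partial>lborel)
      = (\<integral>\<^sup>+p. ennreal (norm (h p)) * W (norm p) \<partial>lborel) * indicator {0..1} t" .
  qed
  also have "\<dots> = (\<integral>\<^sup>+p. ennreal (norm (h p)) * W (norm p) \<partial>lborel)"
    by (subst nn_integral_cmult) auto
  finally show ?thesis .
qed

text \<open>For \<open>v = 0\<close> this is the radial mean inequality for the square of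
  \<open>h\<close>. A general \<open>v\<close> is moved to the origin by the Weyl translation, an
  isometry of the Fock space; \<open>k\<close> is the square of the translated function.\<close>

lemma fock_point_evaluation:
  assumes h: "h holomorphic_on UNIV"
  shows "ennreal ((norm (h v))\<^sup>2 * exp (- \<nu> * (norm v)\<^sup>2)) * gauss_mass \<nu>
    \<le> (\<integral>\<^sup>+t. ennreal ((norm (h t))\<^sup>2 * exp (- \<nu> * (norm t)\<^sup>2)) \<partial>lborel)"
proof -
  have [measurable]: "h \<in> borel_measurable borel"
    using h holomorphic_on_imp_continuous_on borel_measurable_continuous_onI by blast
  \<comment> \<open>The factor \<open>exp (- 2 \<nu> p cnj v)\<close> turns the Gaussian centred at \<open>0\<close> into the one centred at \<open>- v\<close>.\<close>
  define k where "k p = of_real (exp (- \<nu> * (norm v)\<^sup>2)) * ((h (v + p))\<^sup>2 * exp (- 2 * of_real \<nu> * p * cnj v))" for p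
  have "(\<lambda>p. h (v + p)) holomorphic_on UNIV"
    by (rule holomorphic_on_compose[OF _ holomorphic_on_subset[OF h], unfolded o_def])
       (auto intro!: holomorphic_intros)
  then have "k holomorphic_on UNIV"
    unfolding k_def by (intro holomorphic_intros)
  then have "ennreal (norm (k 0)) * gauss_mass \<nu>
      \<le> (\<integral>\<^sup>+p. ennreal (norm (k p)) * ennreal (exp (- \<nu> * (norm p)\<^sup>2)) \<partial>lborel)"
    unfolding gauss_mass_def
    by (rule entire_norm_le_radial_mean[where W = "\<lambda>r. ennreal (exp (- \<nu> * r\<^sup>2))"]) measurable
  also have "norm (k 0) = (norm (h v))\<^sup>2 * exp (- \<nu> * (norm v)\<^sup>2)"
    by (simp add: k_def norm_mult norm_power mult.commute)
  also have "(\<lambda>p. ennreal (norm (k p)) * ennreal (exp (- \<nu> * (norm p)\<^sup>2)))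
     = (\<lambda>p. ennreal ((norm (h (v + 1 *\<^sub>R p)))\<^sup>2 * exp (- \<nu> * (norm (v + 1 *\<^sub>R p))\<^sup>2)))"
  proof
    fix p
    have "(norm (v + p))\<^sup>2 = (norm v)\<^sup>2 + 2 * Re (p * cnj v) + (norm p)\<^sup>2"
      by (simp only: cmod_power2) (simp add: power2_eq_square algebra_simps)
    then have "exp (- \<nu> * (norm v)\<^sup>2) * exp (- 2 * \<nu> * Re (p * cnj v)) * exp (- \<nu> * (norm p)\<^sup>2)
        = exp (- \<nu> * (norm (v + p))\<^sup>2)"
      by (simp add: exp_add[symmetric] algebra_simps)
    moreover have "norm (k p) = (norm (h (v + p)))\<^sup>2 * (exp (- \<nu> * (norm v)\<^sup>2) * exp (- 2 * \<nu> * Re (p * cnj v)))"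
      by (simp add: k_def norm_mult norm_power algebra_simps)
    ultimately have "norm (k p) * exp (- \<nu> * (norm p)\<^sup>2) = (norm (h (v + p)))\<^sup>2 * exp (- \<nu> * (norm (v + p))\<^sup>2)"
      by (simp add: mult.assoc)
    then show "ennreal (norm (k p)) * ennreal (exp (- \<nu> * (norm p)\<^sup>2))
       = ennreal ((norm (h (v + 1 *\<^sub>R p)))\<^sup>2 * exp (- \<nu> * (norm (v + 1 *\<^sub>R p))\<^sup>2))"
      by (simp add: ennreal_mult'[symmetric])
  qed
  also have "(\<integral>\<^sup>+p. ennreal ((norm (h (v + 1 *\<^sub>R p)))\<^sup>2 * exp (- \<nu> * (norm (v + 1 *\<^sub>R p))\<^sup>2)) \<partial>lborel)
     = (\<integral>\<^sup>+t. ennreal ((norm (h t))\<^sup>2 * exp (- \<nu> * (norm t)\<^sup>2)) \<partial>lborel)"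
    using nn_integral_lborel_affine[of "\<lambda>t. ennreal ((norm (h t))\<^sup>2 * exp (- \<nu> * (norm t)\<^sup>2))" 1 v]
    by simp
  finally show ?thesis .
qed


section \<open>Square integrability in two variables versus one\<close>

text \<open>The point evaluation bound is applied in the second variable only, at the point where the
  vertical line through \<open>\<xi>/\<surd>2\<close> meets the range of \<^const>\<open>psi2\<close>.\<close>

lemma fock2_restrict_psi2:
  fixes F :: "complex \<times> complex \<Rightarrow> complex"
  assumes F: "continuous_on UNIV F"
    and hol: "\<And>z. (\<lambda>w. F (z, w)) holomorphic_on UNIV"
    and int: "integrable lborel
      (\<lambda>(z, w). (norm (F (z, w)))\<^sup>2 * exp (- \<nu> * ((norm z)\<^sup>2 + (norm w)\<^sup>2)))"
  shows "integrable lborel (\<lambda>\<xi>. (norm (F (psi2 \<xi>)))\<^sup>2 * exp (- \<nu> * (norm \<xi>)\<^sup>2))"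
proof -
  have [measurable]: "F \<in> borel_measurable (borel \<Otimes>\<^sub>M borel)"
    unfolding borel_prod by (rule borel_measurable_continuous_onI[OF F])
  have [measurable]: "psi2 \<in> borel \<rightarrow>\<^sub>M borel \<Otimes>\<^sub>M borel"
    unfolding borel_prod psi2_def[abs_def]
    by (intro borel_measurable_continuous_onI continuous_intros) auto
  let ?H = "\<lambda>z w. ennreal ((norm (F (z, w)))\<^sup>2 * exp (- \<nu> * (norm w)\<^sup>2)) * ennreal (exp (- \<nu> * (norm z)\<^sup>2))"
  have H: "?H z w = ennreal ((norm (F (z, w)))\<^sup>2 * exp (- \<nu> * ((norm z)\<^sup>2 + (norm w)\<^sup>2)))" for z w
    by (simp add: ennreal_mult'[symmetric] exp_add[symmetric] algebra_simps)
  have "(\<integral>\<^sup>+z. \<integral>\<^sup>+w. ?H z w \<partial>lborel \<partial>lborel) < \<infinity>"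
    using int unfolding H by (subst (asm) integrable_lborel_prod_iff) auto
  have "(\<integral>\<^sup>+\<xi>. ennreal ((norm (F (psi2 \<xi>)))\<^sup>2 * exp (- \<nu> * (norm \<xi>)\<^sup>2)) \<partial>lborel) * gauss_mass \<nu>
    = (\<integral>\<^sup>+\<xi>. ennreal ((norm (F (psi2 \<xi>)))\<^sup>2 * exp (- \<nu> * (norm \<xi>)\<^sup>2)) * gauss_mass \<nu> \<partial>lborel)"
    by (rule nn_integral_multc[symmetric]) measurable
  also have "\<dots> \<le> (\<integral>\<^sup>+\<xi>. \<integral>\<^sup>+w. ?H (0 + (1 / sqrt 2) *\<^sub>R \<xi>) w \<partial>lborel \<partial>lborel)"
  proof (rule nn_integral_mono)
    fix \<xi> :: complex
    define z v where "z = (1 / sqrt 2) *\<^sub>R \<xi>" and "v = - \<i> * \<xi> / of_real (sqrt 2)"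
    have psi: "psi2 \<xi> = (z, v)"
      by (simp add: psi2_def z_def v_def scaleR_conv_of_real)
    \<comment> \<open>\<open>psi2\<close> is an isometry, so the weight at \<open>\<xi>\<close>
      splits into the weights at \<open>z\<close> and \<open>v\<close>.\<close>
    have "(norm z)\<^sup>2 + (norm v)\<^sup>2 = (norm \<xi>)\<^sup>2"
      by (simp add: z_def v_def norm_mult norm_divide power_divide power_mult_distrib)
    then have "(norm (F (psi2 \<xi>)))\<^sup>2 * exp (- \<nu> * (norm \<xi>)\<^sup>2)
      = ((norm (F (z, v)))\<^sup>2 * exp (- \<nu> * (norm v)\<^sup>2)) * exp (- \<nu> * (norm z)\<^sup>2)"
      by (simp add: psi exp_add[symmetric] algebra_simps flip: distrib_left)
    then have "ennreal ((norm (F (psi2 \<xi>)))\<^sup>2 * exp (- \<nu> * (norm \<xi>)\<^sup>2)) * gauss_mass \<nu>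
      = (ennreal ((norm (F (z, v)))\<^sup>2 * exp (- \<nu> * (norm v)\<^sup>2)) * gauss_mass \<nu>) * ennreal (exp (- \<nu> * (norm z)\<^sup>2))"
      by (simp add: ennreal_mult' mult_ac)
    also have "\<dots> \<le> (\<integral>\<^sup>+w. ennreal ((norm (F (z, w)))\<^sup>2 * exp (- \<nu> * (norm w)\<^sup>2)) \<partial>lborel)
        * ennreal (exp (- \<nu> * (norm z)\<^sup>2))"
      by (intro mult_right_mono fock_point_evaluation hol) simp
    also have "\<dots> = (\<integral>\<^sup>+w. ?H z w \<partial>lborel)"
      by (rule nn_integral_multc[symmetric]) measurable
    finally show "ennreal ((norm (F (psi2 \<xi>)))\<^sup>2 * exp (- \<nu> * (norm \<xi>)\<^sup>2)) * gauss_mass \<nu>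
      \<le> (\<integral>\<^sup>+w. ?H (0 + (1 / sqrt 2) *\<^sub>R \<xi>) w \<partial>lborel)"
      by (simp add: z_def)
  qed
  \<comment> \<open>The factor 2 compensates the planar Jacobian of the scaling by
    \<open>1 / sqrt 2\<close>.\<close>
  also have "\<dots> = ennreal 2 * (ennreal (\<bar>1 / sqrt 2\<bar> ^ DIM(complex))
      * (\<integral>\<^sup>+\<xi>. \<integral>\<^sup>+w. ?H (0 + (1 / sqrt 2) *\<^sub>R \<xi>) w \<partial>lborel \<partial>lborel))"
  proof -
    have "ennreal 2 * ennreal (\<bar>1 / sqrt 2\<bar> ^ DIM(complex)) = 1"
      by (subst ennreal_mult'[symmetric]) (auto simp: power_divide)
    then show ?thesis by (simp only: mult.assoc[symmetric] mult_1_left)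
  qed
  also have "ennreal (\<bar>1 / sqrt 2\<bar> ^ DIM(complex))
      * (\<integral>\<^sup>+\<xi>. \<integral>\<^sup>+w. ?H (0 + (1 / sqrt 2) *\<^sub>R \<xi>) w \<partial>lborel \<partial>lborel)
      = (\<integral>\<^sup>+z. \<integral>\<^sup>+w. ?H z w \<partial>lborel \<partial>lborel)"
    by (rule nn_integral_lborel_affine[where g = "\<lambda>z. \<integral>\<^sup>+w. ?H z w \<partial>lborel", symmetric]) auto
  also have "ennreal 2 * (\<integral>\<^sup>+z. \<integral>\<^sup>+w. ?H z w \<partial>lborel \<partial>lborel) < \<infinity>"
    using \<open>(\<integral>\<^sup>+z. \<integral>\<^sup>+w. ?H z w \<partial>lborel \<partial>lborel) < \<infinity>\<close> by (simp add: ennreal_mult_less_top)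
  \<comment> \<open>A finite product with a positive factor has its other factor finite.\<close>
  finally have "(\<integral>\<^sup>+\<xi>. ennreal ((norm (F (psi2 \<xi>)))\<^sup>2 * exp (- \<nu> * (norm \<xi>)\<^sup>2)) \<partial>lborel) < \<infinity>"
    using gauss_mass_pos[of \<nu>] by (auto simp: ennreal_mult_less_top)
  then show ?thesis
    by (simp add: integrable_iff_bounded)
qed

text \<open>Conversely, with \<open>\<xi> = (z + \<i> w)/\<surd>2\<close> one has
  \<open>|z|\<^sup>2 + |w|\<^sup>2 = |\<xi>|\<^sup>2 + |\<xi> - \<i> \<surd>2 w|\<^sup>2\<close>, so the integral over \<open>w\<close> is Gaussian.\<close>

lemma fock2_lift:
  fixes f :: "complex \<Rightarrow> complex"
  assumes \<nu>: "\<nu> > 0" and f: "continuous_on UNIV f"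
    and int: "integrable lborel (\<lambda>\<xi>. (norm (f \<xi>))\<^sup>2 * exp (- \<nu> * (norm \<xi>)\<^sup>2))"
  shows "integrable lborel (\<lambda>(z, w). (norm (f ((z + \<i> * w) / of_real (sqrt 2))))\<^sup>2
      * exp (- \<nu> * ((norm z)\<^sup>2 + (norm w)\<^sup>2)))"
proof -
  have [measurable]: "f \<in> borel_measurable borel"
    by (rule borel_measurable_continuous_onI[OF f])
  define H where "H z w = ennreal ((norm (f ((z + \<i> * w) / of_real (sqrt 2))))\<^sup>2
      * exp (- \<nu> * ((norm z)\<^sup>2 + (norm w)\<^sup>2)))" for z w
  define h where "h \<xi> = ennreal ((norm (f \<xi>))\<^sup>2 * exp (- \<nu> * (norm \<xi>)\<^sup>2))" for \<xi>
  have [measurable]: "(\<lambda>(z, w). H z w) \<in> borel_measurable (borel \<Otimes>\<^sub>M borel)"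
    "h \<in> borel_measurable borel"
    unfolding H_def h_def by measurable
  have fin: "(\<integral>\<^sup>+\<xi>. h \<xi> \<partial>lborel) < \<infinity>"
    using int by (simp add: integrable_iff_bounded h_def)
  have "(\<integral>\<^sup>+z. \<integral>\<^sup>+w. H z w \<partial>lborel \<partial>lborel) = (\<integral>\<^sup>+w. \<integral>\<^sup>+z. H z w \<partial>lborel \<partial>lborel)"
    by (rule lborel_pair.Fubini'[symmetric]) measurable
  \<comment> \<open>For fixed \<open>w\<close>, the relation between \<open>z\<close> and
    \<open>\<xi>\<close> is inverted to \<open>z = - (\<i> * w) + sqrt 2 *\<^sub>R \<xi>\<close>,
    with planar Jacobian 2.\<close>
  also have "\<dots> = (\<integral>\<^sup>+w. ennreal 2 * (\<integral>\<^sup>+\<xi>. h \<xi> * ennreal (exp (- \<nu> * (norm (\<xi> - \<i> * sqrt 2 * w))\<^sup>2)) \<partial>lborel) \<partial>lborel)"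
  proof (rule nn_integral_cong)
    fix w :: complex
    have "H (- (\<i> * w) + sqrt 2 *\<^sub>R \<xi>) w = h \<xi> * ennreal (exp (- \<nu> * (norm (\<xi> - \<i> * sqrt 2 * w))\<^sup>2))" for \<xi>
    proof -
      have "(norm (- (\<i> * w) + sqrt 2 *\<^sub>R \<xi>))\<^sup>2 + (norm w)\<^sup>2 = (norm \<xi>)\<^sup>2 + (norm (\<xi> - \<i> * sqrt 2 * w))\<^sup>2"
        by (simp only: cmod_power2) (simp add: power2_eq_square algebra_simps)
      then show ?thesis
        unfolding H_def h_def
        by (simp add: ennreal_mult'[symmetric] scaleR_conv_of_real exp_add[symmetric] mult.assoc
            flip: distrib_left)
          (simp add: algebra_simps flip: exp_add)
    qed
    then show "(\<integral>\<^sup>+z. H z w \<partial>lborel)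
      = ennreal 2 * (\<integral>\<^sup>+\<xi>. h \<xi> * ennreal (exp (- \<nu> * (norm (\<xi> - \<i> * sqrt 2 * w))\<^sup>2)) \<partial>lborel)"
      using nn_integral_lborel_affine[of "\<lambda>z. H z w" "sqrt 2" "- (\<i> * w)"] by simp
  qed
  also have "\<dots> = ennreal 2 * (\<integral>\<^sup>+w. \<integral>\<^sup>+\<xi>. h \<xi> * ennreal (exp (- \<nu> * (norm (\<xi> - \<i> * sqrt 2 * w))\<^sup>2)) \<partial>lborel \<partial>lborel)"
    by (rule nn_integral_cmult) measurable
  also have "(\<integral>\<^sup>+w. \<integral>\<^sup>+\<xi>. h \<xi> * ennreal (exp (- \<nu> * (norm (\<xi> - \<i> * sqrt 2 * w))\<^sup>2)) \<partial>lborel \<partial>lborel)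
    = (\<integral>\<^sup>+\<xi>. \<integral>\<^sup>+w. h \<xi> * ennreal (exp (- \<nu> * (norm (\<xi> - \<i> * sqrt 2 * w))\<^sup>2)) \<partial>lborel \<partial>lborel)"
    by (rule lborel_pair.Fubini'[symmetric]) measurable
  also have "\<dots> \<le> (\<integral>\<^sup>+\<xi>. h \<xi> * gauss_mass \<nu> \<partial>lborel)"
  proof (rule nn_integral_mono)
    fix \<xi> :: complex
    have "norm (\<xi> - \<i> * sqrt 2 * w) = norm (\<i> * \<xi> + sqrt 2 *\<^sub>R w)" for w
    proof -
      have "\<i> * \<xi> + sqrt 2 *\<^sub>R w = \<i> * (\<xi> - \<i> * sqrt 2 * w)"
        by (simp add: scaleR_conv_of_real algebra_simps)
      then show ?thesis by (simp add: norm_mult)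
    qed
    \<comment> \<open>After a rotation by a right angle the exponent is affine in \<open>w\<close>
      with scale \<open>sqrt 2\<close>, so the inner integral is half of the Gaussian mass. Only the
      bound by the full mass is kept.\<close>
    then have "gauss_mass \<nu> = ennreal 2 * (\<integral>\<^sup>+w. ennreal (exp (- \<nu> * (norm (\<xi> - \<i> * sqrt 2 * w))\<^sup>2)) \<partial>lborel)"
      using nn_integral_lborel_affine[of "\<lambda>w. ennreal (exp (- \<nu> * (norm w)\<^sup>2))" "sqrt 2" "\<i> * \<xi>"]
      by (simp add: gauss_mass_def)
    also have "\<dots> \<ge> 1 * (\<integral>\<^sup>+w. ennreal (exp (- \<nu> * (norm (\<xi> - \<i> * sqrt 2 * w))\<^sup>2)) \<partial>lborel)"
      by (intro mult_right_mono) auto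
    finally show "(\<integral>\<^sup>+w. h \<xi> * ennreal (exp (- \<nu> * (norm (\<xi> - \<i> * sqrt 2 * w))\<^sup>2)) \<partial>lborel) \<le> h \<xi> * gauss_mass \<nu>"
      by (subst nn_integral_cmult) (auto intro: mult_left_mono)
  qed
  also have "\<dots> = (\<integral>\<^sup>+\<xi>. h \<xi> \<partial>lborel) * gauss_mass \<nu>"
    by (rule nn_integral_multc) measurable
  finally have "(\<integral>\<^sup>+z. \<integral>\<^sup>+w. H z w \<partial>lborel \<partial>lborel) \<le> ennreal 2 * ((\<integral>\<^sup>+\<xi>. h \<xi> \<partial>lborel) * gauss_mass \<nu>)"
    by (simp add: mult_left_mono)
  also have "\<dots> < \<infinity>"
    using fin gauss_mass_finite[OF \<nu>] by (simp add: ennreal_mult_less_top)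
  finally show ?thesis
    unfolding H_def by (subst integrable_lborel_prod_iff) auto
qed

section \<open>Slice extension of power series\<close>

lemma imag_units_square: "I \<in> imag_units \<Longrightarrow> I * I = -1"
  by (simp add: imag_units_def power2_eq_square)

lemma imag_units_norm: "I \<in> imag_units \<Longrightarrow> norm I = 1"
  by (auto simp: imag_units_iff norm_quat_def inner_quat_def power2_eq_square)

lemma emb_Complex: "emb I (Complex x y) = of_real x + of_real y * I"
  by (simp add: emb_def)

lemma emb_add: "emb I (z + w) = emb I z + emb I w"
  by (simp add: emb_def algebra_simps)

lemma emb_scaleR: "emb I (r *\<^sub>R z) = r *\<^sub>R emb I z"
  by (simp add: emb_def scaleR_conv_of_real algebra_simps)

lemma emb_of_real [simp]: "emb I (of_real x) = of_real x"
  by (simp add: emb_def)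

lemma emb_one [simp]: "emb I 1 = 1"
  by (simp add: emb_def)

lemma emb_mult:
  assumes "I \<in> imag_units"
  shows "emb I (z * w) = emb I z * emb I w"
  using imag_units_square[OF assms]
  by (simp add: emb_def scaleR_conv_of_real[symmetric] of_real_def algebra_simps)

lemma emb_power: "I \<in> imag_units \<Longrightarrow> emb I (z ^ n) = emb I z ^ n"
  by (induction n) (simp_all add: emb_mult)

lemma emb_cnj: "I \<in> imag_units \<Longrightarrow> emb I (cnj z) = qcnj (emb I z)"
  by (auto simp: imag_units_iff emb_def quat_eq_iff)

lemma norm_emb:
  assumes "I \<in> imag_units"
  shows "norm (emb I z) = norm z"
proof -
  have I: "qRe I = 0" "(qIm1 I)\<^sup>2 + (qIm2 I)\<^sup>2 + (qIm3 I)\<^sup>2 = 1"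
    using assms by (auto simp: imag_units_iff)
  have "(norm (emb I z))\<^sup>2 = (Re z)\<^sup>2 + (Im z)\<^sup>2 * ((qIm1 I)\<^sup>2 + (qIm2 I)\<^sup>2 + (qIm3 I)\<^sup>2)"
    unfolding power2_norm_eq_inner
    by (simp add: I(1) emb_def inner_quat_def power_mult_distrib algebra_simps flip: power2_eq_square)
  also have "\<dots> = (norm z)\<^sup>2"
    by (simp add: I(2) cmod_power2)
  finally show ?thesis by simp
qed

lemma bounded_linear_emb: "I \<in> imag_units \<Longrightarrow> bounded_linear (emb I)"
  by (rule bounded_linear_intro[where K = 1]) (simp_all add: emb_add emb_scaleR norm_emb)

lemma slice_eq_range_emb: "slice I = range (emb I)"
proof -
  have "of_real x + of_real y * I \<in> range (emb I)" for x y
    by (metis emb_Complex rangeI)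
  then show ?thesis by (auto simp: slice_def emb_def)
qed

lemma quat_in_some_slice:
  obtains J z where "J \<in> imag_units" "q = emb J z"
proof (cases "qVec q = 0")
  case True
  \<comment> \<open>A real quaternion lies in every slice, so any unit serves as a witness.\<close>
  have "Quat 0 1 0 0 \<in> imag_units" by (simp add: imag_units_iff)
  moreover have "q = emb (Quat 0 1 0 0) (of_real (qRe q))"
    using True by (simp add: qVec_def)
  ultimately show ?thesis using that by blast
next
  case False
  define y where "y = norm (qVec q)"
  define J where "J = qVec q /\<^sub>R y"
  have y: "y \<noteq> 0" using False by (simp add: y_def)
  have "(qIm1 q)\<^sup>2 + (qIm2 q)\<^sup>2 + (qIm3 q)\<^sup>2 = y\<^sup>2"
    unfolding y_def power2_norm_eq_inner by (simp add: inner_quat_def qVec_def power2_eq_square)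
  then have "((qIm1 q)\<^sup>2 + (qIm2 q)\<^sup>2 + (qIm3 q)\<^sup>2) / y\<^sup>2 = 1"
    using y by simp
  then have "J \<in> imag_units"
    by (simp add: imag_units_iff J_def qVec_def power_divide divide_inverse_commute[symmetric]
        add_divide_distrib)
  moreover have "q = emb J (Complex (qRe q) y)"
    using y by (simp add: emb_Complex J_def scaleR_conv_of_real[symmetric])
      (simp add: qVec_def scaleR_conv_of_real mult.assoc[symmetric] flip: of_real_mult)
  ultimately show ?thesis using that by blast
qed

section \<open>Extensions as quaternionic power series and their regularity\<close>

lemma Ext_emb:
  assumes "J \<in> imag_units"
  shows "Ext i f (emb J z) = (1/2) *\<^sub>R (emb i (f z) + emb i (f (cnj z)))
    + (1/2) *\<^sub>R (J * i * (emb i (f (cnj z)) - emb i (f z)))"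
  using Ext_formula[OF assms, of i f "Re z" "Im z"] by (simp add: emb_def complex_cnj[symmetric])

lemma Ext_emb_self:
  assumes "i \<in> imag_units"
  shows "Ext i f (emb i z) = emb i (f z)"
proof -
  have "Ext i f (emb i z)
    = (1/2) *\<^sub>R ((emb i (f z) + emb i (f (cnj z))) + (- 1) * (emb i (f (cnj z)) - emb i (f z)))"
    unfolding Ext_emb[OF assms] imag_units_square[OF assms] scaleR_add_right ..
  also have "\<dots> = (1/2) *\<^sub>R (2 *\<^sub>R emb i (f z))"
    unfolding scaleR_2 by (rule arg_cong[where f = "\<lambda>x. (1/2) *\<^sub>R x"]) simp
  finally show ?thesis by simp
qed

text \<open>With \<open>w = z ^ n\<close>, conjugation commutes with powers, so the extension
  formula recombines the real and imaginary parts of \<open>w\<close> into \<open>emb J w\<close>, a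
  power of \<open>q\<close>. The coefficient ends up on the right, away from the left factor
  \<open>J * i\<close>.\<close>

lemma Ext_monomial:
  assumes i: "i \<in> imag_units"
  shows "Ext i (\<lambda>z. a * z ^ n) q = q ^ n * emb i a"
proof -
  obtain J z where J: "J \<in> imag_units" and q: "q = emb J z"
    by (rule quat_in_some_slice)
  define w where "w = z ^ n"
  \<comment> \<open>Commutativity inside the slice of \<open>i\<close> is what moves the coefficient
    to the right.\<close>
  have *: "emb i (a * u) = emb i u * emb i a" for u
    using emb_mult[OF i, of u a] by (simp add: mult.commute)
  have "Ext i (\<lambda>z. a * z ^ n) q
    = ((1/2) *\<^sub>R (emb i w + emb i (cnj w)) + (1/2) *\<^sub>R (J * i * (emb i (cnj w) - emb i w))) * emb i a"
    unfolding q Ext_emb[OF J] * w_def by (simp add: algebra_simps)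
  also have "emb i w + emb i (cnj w) = 2 *\<^sub>R of_real (Re w)"
    by (simp add: emb_def scaleR_2)
  also have "emb i (cnj w) - emb i w = (- 2) *\<^sub>R (of_real (Im w) * i)"
    by (simp add: emb_def scaleR_2)
  also have "J * i * ((- 2) *\<^sub>R (of_real (Im w) * i)) = 2 *\<^sub>R (of_real (Im w) * J)"
  proof -
    have "J * i * i = - J"
      using imag_units_square[OF i] by (simp add: mult.assoc)
    then show ?thesis by (simp add: scaleR_conv_of_real[symmetric])
  qed
  also have "(1/2) *\<^sub>R 2 *\<^sub>R of_real (Re w) + (1/2) *\<^sub>R 2 *\<^sub>R (of_real (Im w) * J) = emb J w"
    by (simp add: emb_def)
  also have "emb J w = q ^ n"
    by (simp add: w_def q emb_power J)
  finally show ?thesis .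
qed

text \<open>At a fixed \<open>q\<close>, the extension is a fixed real-linear combination of two
  values of \<open>f\<close>, hence compatible with convergent series.\<close>

lemma Ext_sums:
  assumes i: "i \<in> imag_units" and f: "\<And>z. (\<lambda>n. a n * z ^ n) sums f z"
  shows "(\<lambda>n. q ^ n * emb i (a n)) sums Ext i f q"
proof -
  obtain J z where J: "J \<in> imag_units" and q: "q = emb J z"
    by (rule quat_in_some_slice)
  have s: "(\<lambda>n. emb i (a n * u ^ n)) sums emb i (f u)" for u
    by (rule bounded_linear.sums[OF bounded_linear_emb[OF i] f])
  have "(\<lambda>n. Ext i (\<lambda>z. a n * z ^ n) q) sums Ext i f q"
    unfolding q Ext_emb[OF J]
    by (intro sums_add sums_scaleR_right sums_mult sums_diff s)
  then show ?thesis
    by (simp add: Ext_monomial i)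
qed

text \<open>Without commutativity the derivative is a sum of products with \<open>h\<close> at every
  position. An unspecified derivative with its norm bound is therefore carried through the
  induction.\<close>

lemma has_derivative_power_bounded:
  fixes q :: "'a::real_normed_algebra_1"
  shows "\<exists>D. ((\<lambda>q. q ^ n) has_derivative D) (at q) \<and>
    (\<forall>h. norm (D h) \<le> real n * norm q ^ (n - 1) * norm h)"
proof (induction n)
  case 0
  show ?case by (intro exI[of _ "\<lambda>_. 0"]) simp
next
  case (Suc n)
  then obtain D where D: "((\<lambda>q. q ^ n) has_derivative D) (at q)"
    and le: "\<And>h. norm (D h) \<le> real n * norm q ^ (n - 1) * norm h"
    by blast
  have "((\<lambda>q. q * q ^ n) has_derivative (\<lambda>h. q * D h + h * q ^ n)) (at q)"
    by (rule has_derivative_mult[OF has_derivative_ident D])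
  moreover have "norm (q * D h + h * q ^ n) \<le> real (Suc n) * norm q ^ n * norm h" for h
  proof -
    have "norm (q * D h) \<le> norm q * (real n * norm q ^ (n - 1) * norm h)"
      by (rule order.trans[OF norm_mult_ineq]) (intro mult_left_mono le norm_ge_zero)
    also have "\<dots> = real n * norm q ^ n * norm h"
      by (cases n) auto
    finally have "norm (q * D h) \<le> real n * norm q ^ n * norm h" .
    moreover have "norm (h * q ^ n) \<le> norm h * norm q ^ n"
      by (rule order.trans[OF norm_mult_ineq]) (intro mult_left_mono norm_power_ineq norm_ge_zero)
    ultimately show ?thesis
      by (intro order.trans[OF norm_triangle_ineq]) (simp add: algebra_simps)
  qed
  ultimately show ?case by auto
qed

text \<open>Termwise differentiation on a ball around 0: the derivatives of the terms have the
  summable majorant \<open>B\<close>, so their partial sums converge uniformly in operator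
  norm.\<close>

lemma power_series_differentiable:
  fixes c :: "nat \<Rightarrow> 'a::{real_normed_algebra_1, banach}"
  assumes s: "\<And>q. (\<lambda>n. q ^ n * c n) sums g q"
    and c: "\<And>r. r > 0 \<Longrightarrow> summable (\<lambda>n. norm (c n) * r ^ n)"
  shows "g differentiable (at q)"
proof -
  define R where "R = norm q + 1"
  have R: "R \<ge> 1" by (simp add: R_def)
  obtain D where D: "\<And>n x. ((\<lambda>q::'a. q ^ n) has_derivative D n x) (at x)"
    and Dle: "\<And>n x h. norm (D n x h) \<le> real n * norm x ^ (n - 1) * norm h"
    using has_derivative_power_bounded by metis
  define f' where "f' n x h = D n x h * c n" for n x h
  \<comment> \<open>The extra power of 2 absorbs the factor \<open>n\<close> from differentiating;
    \<open>R \<ge> 1\<close> absorbs the drop of the exponent to \<open>n - 1\<close>.\<close>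
  define B where "B n = norm (c n) * (2 * R) ^ n" for n
  have B: "summable B"
    unfolding B_def using R by (intro c) simp
  have B0: "B n \<ge> 0" for n
    using R by (simp add: B_def)
  have f'le: "norm (f' n x h) \<le> B n * norm h" if "x \<in> ball 0 R" for n x h
  proof -
    have "real n * norm x ^ (n - 1) \<le> 2 ^ n * R ^ n"
    proof (rule mult_mono)
      show "real n \<le> 2 ^ n" using of_nat_less_two_power[of n, where 'a = real] by simp
      have "norm x ^ (n - 1) \<le> R ^ (n - 1)"
        using that by (intro power_mono) auto
      also have "\<dots> \<le> R ^ n" using R by (intro power_increasing) auto
      finally show "norm x ^ (n - 1) \<le> R ^ n" .
    qed auto
    then have "norm (D n x h) \<le> (2 * R) ^ n * norm h"
      by (intro order.trans[OF Dle] mult_right_mono) (auto simp: power_mult_distrib)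
    then have "norm (D n x h) * norm (c n) \<le> ((2 * R) ^ n * norm h) * norm (c n)"
      by (rule mult_right_mono) simp
    then show ?thesis
      unfolding f'_def B_def by (intro order.trans[OF norm_mult_ineq]) (simp add: mult_ac)
  qed
  have f's: "summable (\<lambda>n. f' n x h)" if "x \<in> ball 0 R" for x h
    by (rule summable_comparison_test'[OF summable_mult2[OF B, of "norm h"]]) (rule f'le[OF that])
  define g' where "g' x h = (\<Sum>n. f' n x h)" for x h
  have "\<exists>k. \<forall>x\<in>ball 0 R. (\<lambda>n. x ^ n * c n) sums (k x) \<and> (k has_derivative g' x) (at x within ball 0 R)"
  proof (rule has_derivative_series)
    show "convex (ball (0::'a) R)" by simp
    show "((\<lambda>x. x ^ n * c n) has_derivative f' n x) (at x within ball 0 R)" for n x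
      unfolding f'_def
      by (rule has_derivative_mult_left[OF has_derivative_at_withinI[OF D]])
    show "\<forall>\<^sub>F n in sequentially. \<forall>x\<in>ball 0 R. \<forall>h. norm ((\<Sum>j<n. f' j x h) - g' x h) \<le> e * norm h"
      if "e > 0" for e
    proof -
      have "\<forall>\<^sub>F n in sequentially. norm ((\<Sum>j<n. B j) - suminf B) < e"
        using tendstoD[OF summable_LIMSEQ[OF B] \<open>e > 0\<close>] by (simp add: dist_norm)
      then show ?thesis
      proof eventually_elim
        case (elim n)
        show ?case
        proof (intro ballI allI)
          fix x h assume x: "x \<in> ball (0::'a) R"
          \<comment> \<open>The error is the tail of the derivative series, bounded by the tail of
            \<open>B\<close> uniformly in \<open>x\<close>.\<close>
          have "g' x h - (\<Sum>j<n. f' j x h) = (\<Sum>j. f' (j + n) x h)"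
            unfolding g'_def by (subst suminf_minus_initial_segment[OF f's[OF x]]) simp
          also have "norm \<dots> \<le> (\<Sum>j. B (j + n) * norm h)"
            using summable_mult2[OF B, of "norm h"]
            by (intro norm_suminf_le f'le[OF x]) (subst summable_iff_shift)
          also have "\<dots> = (suminf B - (\<Sum>j<n. B j)) * norm h"
            using suminf_mult2[of "\<lambda>j. B (j + n)" "norm h"] summable_iff_shift[of B n] B
              suminf_minus_initial_segment[OF B, of n] by simp
          also have "\<dots> \<le> e * norm h"
            using elim by (intro mult_right_mono) auto
          finally show "norm ((\<Sum>j<n. f' j x h) - g' x h) \<le> e * norm h"
            by (simp add: norm_minus_commute)
        qed
      qed
    qed
    show "q \<in> ball 0 R" by (simp add: R_def)
    show "(\<lambda>n. q ^ n * c n) sums g q" by (rule s)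
  qed
  then obtain k where k: "\<And>x. x \<in> ball 0 R \<Longrightarrow> (\<lambda>n. x ^ n * c n) sums (k x)"
    "\<And>x. x \<in> ball 0 R \<Longrightarrow> (k has_derivative g' x) (at x within ball 0 R)"
    by blast
  have q: "q \<in> ball 0 R" by (simp add: R_def)
  have "(k has_derivative g' q) (at q)"
    using k(2)[OF q] at_within_open[OF q open_ball] by simp
  then have "(g has_derivative g' q) (at q)"
    by (rule has_derivative_transform_within_open[OF _ open_ball q])
       (use k(1) s sums_unique2 in blast)
  then show ?thesis
    by (auto simp: differentiable_def)
qed

lemma entire_power_series:
  assumes f: "f holomorphic_on UNIV"
  obtains a where "\<And>z. (\<lambda>n. a n * z ^ n) sums f z"
    and "\<And>r. r > 0 \<Longrightarrow> summable (\<lambda>n. norm (a n) * r ^ n)"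
proof
  define a where "a = (\<lambda>n. (deriv ^^ n) f 0 / fact n)"
  show s: "(\<lambda>n. a n * z ^ n) sums f z" for z
    using holomorphic_power_series[of f 0 "norm z + 1" z] f holomorphic_on_subset
    by (auto simp: a_def)
  fix r :: real assume r: "r > 0"
  \<comment> \<open>Convergence at the larger point \<open>r + 1\<close> gives absolute convergence
    at \<open>r\<close>.\<close>
  have "summable (\<lambda>n. norm (a n * of_real r ^ n))"
    by (rule powser_insidea[OF sums_summable[OF s[of "of_real (r + 1)"]]]) (use r in auto)
  then show "summable (\<lambda>n. norm (a n) * r ^ n)"
    using r by (simp add: norm_mult norm_power)
qed

text \<open>Differentiability on all quaternions comes from the power series. The Cauchy-Riemann
  equation comes from differentiating the extension formula on one slice, where only the derivatives
  \<open>A\<close> and \<open>B\<close> of \<open>f\<close> at two conjugate points enter.\<close>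

lemma slice_regular_Ext:
  assumes i: "i \<in> imag_units" and f: "f holomorphic_on UNIV"
  shows "slice_regular (Ext i f)"
  unfolding slice_regular_def
proof (intro conjI allI ballI)
  obtain a where a: "\<And>z. (\<lambda>n. a n * z ^ n) sums f z"
    "\<And>r. r > 0 \<Longrightarrow> summable (\<lambda>n. norm (a n) * r ^ n)"
    using entire_power_series[OF f] by blast
  show "Ext i f differentiable (at q)" for q
    by (rule power_series_differentiable[where c = "\<lambda>n. emb i (a n)"])
       (use a Ext_sums[OF i a(1)] in \<open>auto simp: norm_emb i\<close>)
next
  fix I x y assume I: "I \<in> imag_units"
  define A where "A = emb i (deriv f (Complex x y))"
  define B where "B = emb i (deriv f (Complex x (- y)))"
  have df: "(f has_field_derivative deriv f z) (at z)" for z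
    using f holomorphic_derivI open_UNIV by blast
  have chain: "((\<lambda>t. emb i (f (\<gamma> t))) has_vector_derivative emb i (\<gamma>' * deriv f (\<gamma> t))) (at t)"
    if "(\<gamma> has_vector_derivative \<gamma>') (at t)" for \<gamma> \<gamma>' and t :: real
    using bounded_linear.has_vector_derivative[OF bounded_linear_emb[OF i]
        field_vector_diff_chain_at[OF that df]]
    by (simp add: o_def)
  have v1: "((\<lambda>t. Complex t b) has_vector_derivative 1) (at t)" for t b
    unfolding Complex_eq by (auto intro!: derivative_eq_intros)
  have v2: "((\<lambda>t. Complex b t) has_vector_derivative \<i>) (at t)"
    "((\<lambda>t. Complex b (- t)) has_vector_derivative - \<i>) (at t)" for t b
    unfolding Complex_eq by (auto intro!: derivative_eq_intros)
  have emb_i: "emb i (\<i> * z) = i * emb i z" "emb i (- (\<i> * z)) = - (i * emb i z)" for z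
    using emb_mult[OF i, of \<i> z] emb_scaleR[of i "-1" "\<i> * z"] by (simp_all add: emb_def)
  note h = has_vector_derivative_add has_vector_derivative_diff
    bounded_linear.has_vector_derivative[OF bounded_linear_scaleR_right]
    bounded_linear.has_vector_derivative[OF bounded_linear_mult_right]
  have "((\<lambda>t. Ext i f (of_real t + of_real y * I)) has_vector_derivative
     (1/2) *\<^sub>R (A + B) + (1/2) *\<^sub>R (I * i * (B - A))) (at x)"
    unfolding Ext_formula[OF I] A_def B_def
    by (intro h) (use chain[OF v1] in auto)
  moreover have "((\<lambda>t. Ext i f (of_real x + of_real t * I)) has_vector_derivative
     (1/2) *\<^sub>R (i * A + - (i * B)) + (1/2) *\<^sub>R (I * i * (- (i * B) - i * A))) (at y)"
    unfolding Ext_formula[OF I] A_def B_def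
    by (intro h) (use chain[OF v2(1)] chain[OF v2(2)] in \<open>auto simp: emb_i\<close>)
  moreover have "(1/2) *\<^sub>R (A + B) + (1/2) *\<^sub>R (I * i * (B - A))
     + I * ((1/2) *\<^sub>R (i * A + - (i * B)) + (1/2) *\<^sub>R (I * i * (- (i * B) - i * A))) = 0"
  proof -
    have 1: "i * (i * q) = - q" "I * (I * q) = - q" for q
      using imag_units_square i I by (simp_all add: mult.assoc[symmetric])
    show ?thesis by (simp add: algebra_simps 1)
  qed
  ultimately show "vector_derivative (\<lambda>t. Ext i f (of_real t + of_real y * I)) (at x)
      + I * vector_derivative (\<lambda>t. Ext i f (of_real x + of_real t * I)) (at y) = 0"
    by (simp only: vector_derivative_at)
qed

section \<open>The identity theorem for slice regular functions\<close>

text \<open>The real functional \<open>inner _ a\<close> made complex linear for left multiplication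
  by \<open>I\<close>. Its real part is that functional, so letting \<open>a\<close> vary recovers
  the quaternion; for \<open>a = 1\<close> it inverts \<open>emb I\<close> on the slice.\<close>

definition slice_coord :: "quat \<Rightarrow> quat \<Rightarrow> quat \<Rightarrow> complex" where
  "slice_coord I a q = Complex (inner q a) (- inner (I * q) a)"

lemma bounded_linear_slice_coord: "bounded_linear (slice_coord I a)"
  unfolding slice_coord_def[abs_def] Complex_eq
  by (intro bounded_linear_add bounded_linear_const_mult bounded_linear_compose[OF bounded_linear_of_real]
      bounded_linear_minus bounded_linear_inner_left
      bounded_linear_compose[OF bounded_linear_inner_left bounded_linear_mult_right])

lemma slice_coord_mult:
  assumes "I \<in> imag_units"
  shows "slice_coord I a (I * q) = \<i> * slice_coord I a q"
  using imag_units_square[OF assms]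
  by (simp add: slice_coord_def complex_eq_iff mult.assoc[symmetric])

lemma slice_coord_emb:
  assumes "I \<in> imag_units"
  shows "slice_coord I 1 (emb I z) = z"
proof -
  have re: "qRe (emb I z) = Re z" for z
    using assms by (simp add: emb_def imag_units_iff)
  have "I * emb I z = emb I (\<i> * z)"
    using emb_mult[OF assms, of \<i> z] by (simp add: emb_def)
  then show ?thesis
    by (simp add: slice_coord_def complex_eq_iff inner_quat_def re)
qed

text \<open>On the slice, the regularity equation says that the real derivative \<open>D\<close>
  satisfies \<open>D I = I * D 1\<close>. The coordinate turns this into complex linearity.\<close>

lemma slice_regular_coord_holomorphic:
  assumes G: "slice_regular G" and I: "I \<in> imag_units"
  shows "(\<lambda>z. slice_coord I a (G (emb I z))) holomorphic_on UNIV"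
proof -
  have "\<exists>d. ((\<lambda>z. slice_coord I a (G (emb I z))) has_field_derivative d) (at z)" for z
  proof -
    obtain D where D: "(G has_derivative D) (at (emb I z))"
      using G unfolding slice_regular_def differentiable_def by blast
    interpret D: bounded_linear D using D by (rule has_derivative_bounded_linear)
    define x y where "x = Re z" and "y = Im z"
    have z: "emb I z = of_real x + of_real y * I" by (simp add: emb_def x_def y_def)
    have "((\<lambda>t. of_real t + of_real y * I) has_vector_derivative 1) (at x)"
      "((\<lambda>t. of_real x + of_real t * I) has_vector_derivative I) (at y)"
      by (auto intro!: derivative_eq_intros)
    \<comment> \<open>Differentiability of \<open>G\<close> identifies the two values of
      \<open>vector_derivative\<close> in the definition of regularity with \<open>D 1\<close> and
      \<open>D I\<close>.\<close>
    from this[THEN vector_derivative_diff_chain_within[where g = G and g' = D and S = UNIV]]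
    have "((\<lambda>t. G (of_real t + of_real y * I)) has_vector_derivative D 1) (at x)"
      "((\<lambda>t. G (of_real x + of_real t * I)) has_vector_derivative D I) (at y)"
      using D by (auto simp: o_def z has_derivative_at_withinI)
    then have "D 1 + I * D I = 0"
      using G I unfolding slice_regular_def by (metis vector_derivative_at)
    then have "I * (D 1 + I * D I) = 0" by simp
    then have DI: "D I = I * D 1"
      using imag_units_square[OF I] by (simp add: algebra_simps flip: mult.assoc)
    have "((\<lambda>z. slice_coord I a (G (emb I z))) has_derivative (\<lambda>h. slice_coord I a (D (emb I h)))) (at z)"
      by (intro bounded_linear.has_derivative[OF bounded_linear_slice_coord]
          has_derivative_compose[OF bounded_linear.has_derivative[OF bounded_linear_emb[OF I] has_derivative_ident] D])
    moreover have "slice_coord I a (D (emb I h)) = slice_coord I a (D 1) * h" for h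
    proof -
      interpret c: bounded_linear "slice_coord I a" by (rule bounded_linear_slice_coord)
      have "D (emb I h) = Re h *\<^sub>R D 1 + Im h *\<^sub>R (I * D 1)"
        unfolding DI[symmetric] D.scaleR[symmetric] D.add[symmetric]
        by (simp add: emb_def scaleR_conv_of_real)
      then show ?thesis
        by (simp add: c.add c.scaleR slice_coord_mult[OF I] complex_eq_iff algebra_simps)
    qed
    ultimately show ?thesis by (auto simp: has_field_derivative_def)
  qed
  then show ?thesis
    by (auto simp: holomorphic_on_def field_differentiable_def intro: field_differentiable_at_within)
qed

text \<open>The real axis lies in every slice and accumulates at 0. On each slice, every coordinate
  of the difference is entire and vanishes on that axis, hence everywhere.\<close>

lemma slice_regular_eqI:
  assumes G: "slice_regular G" and H: "slice_regular H"
    and eq: "\<And>x. G (of_real x) = H (of_real x)"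
  shows "G = H"
proof
  fix q
  obtain I z where I: "I \<in> imag_units" and q: "q = emb I z"
    by (rule quat_in_some_slice)
  have "slice_coord I a (G q) = slice_coord I a (H q)" for a
  proof -
    let ?d = "\<lambda>z. slice_coord I a (G (emb I z)) - slice_coord I a (H (emb I z))"
    have "?d z = 0"
    proof (rule analytic_continuation[of ?d UNIV "\<real>" 0])
      show "?d holomorphic_on UNIV"
        by (intro holomorphic_on_diff slice_regular_coord_holomorphic G H I)
      show "?d u = 0" if "u \<in> \<real>" for u
        using that eq by (auto elim!: Reals_cases)
      show "(0::complex) islimpt \<real>"
        unfolding islimpt_approachable
      proof (intro allI impI)
        fix e :: real assume "e > 0"
        then show "\<exists>x'\<in>\<real>. x' \<noteq> 0 \<and> dist x' (0::complex) < e"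
          by (intro bexI[of _ "of_real (e / 2)"]) (auto simp: norm_divide)
      qed
    qed auto
    then show ?thesis by (simp add: q)
  qed
  then have "inner (G q) a = inner (H q) a" for a
    by (metis slice_coord_def complex.sel(1))
  then show "G q = H q"
    by (metis inner_eq_zero_iff inner_diff_left right_minus_eq)
qed

section \<open>The transform\<close>

lemma holomorphic2_along_line:
  assumes F: "holomorphic2 F"
  shows "(\<lambda>\<xi>. F (u + p * \<xi>, v + q * \<xi>)) holomorphic_on UNIV"
proof -
  have "\<exists>d. ((\<lambda>\<xi>. F (u + p * \<xi>, v + q * \<xi>)) has_field_derivative d) (at \<xi>)" for \<xi>
  proof -
    obtain a b where F': "(F has_derivative (\<lambda>h. a * fst h + b * snd h)) (at (u + p * \<xi>, v + q * \<xi>))"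
      using F unfolding holomorphic2_def by blast
    have "((\<lambda>\<xi>. (u + p * \<xi>, v + q * \<xi>)) has_derivative (\<lambda>h. (p * h, q * h))) (at \<xi>)"
      by (auto intro!: derivative_eq_intros)
    from has_derivative_compose[OF this F']
    have "((\<lambda>\<xi>. F (u + p * \<xi>, v + q * \<xi>)) has_derivative (\<lambda>h. a * (p * h) + b * (q * h))) (at \<xi>)"
      by simp
    also have "(\<lambda>h. a * (p * h) + b * (q * h)) = (*) (a * p + b * q)"
      by (auto simp: fun_eq_iff algebra_simps)
    finally show ?thesis by (auto simp: has_field_derivative_def)
  qed
  then show ?thesis
    by (auto simp: holomorphic_on_def field_differentiable_def intro: has_field_derivative_at_within)
qed

lemma holomorphic2_continuous:
  "holomorphic2 F \<Longrightarrow> continuous_on UNIV F"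
  unfolding holomorphic2_def
  by (metis continuous_at_imp_continuous_on has_derivative_continuous)

lemma holomorphic2_psi2:
  assumes "holomorphic2 F"
  shows "(F \<circ> psi2) holomorphic_on UNIV"
  using holomorphic2_along_line[OF assms, of 0 "1 / of_real (sqrt 2)" 0 "- \<i> / of_real (sqrt 2)"]
  by (simp add: o_def psi2_def)

lemma holomorphic2_lift:
  assumes f: "f holomorphic_on UNIV"
  shows "holomorphic2 (\<lambda>(z, w). f ((z + \<i> * w) / of_real (sqrt 2)))"
  unfolding holomorphic2_def
proof
  fix p :: "complex \<times> complex"
  define d where "d = deriv f ((fst p + \<i> * snd p) / of_real (sqrt 2))"
  have f': "(f has_derivative (*) d) (at ((fst p + \<i> * snd p) / of_real (sqrt 2)))"
    using holomorphic_derivI[OF f open_UNIV UNIV_I] by (auto simp: d_def has_field_derivative_def)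
  have "((\<lambda>p. (fst p + \<i> * snd p) / of_real (sqrt 2)) has_derivative
      (\<lambda>h. (fst h + \<i> * snd h) / of_real (sqrt 2))) (at p)"
    by (auto intro!: derivative_eq_intros)
  from has_derivative_compose[OF this f']
  have "((\<lambda>(z, w). f ((z + \<i> * w) / of_real (sqrt 2))) has_derivative
      (\<lambda>h. (d / of_real (sqrt 2)) * fst h + (d * \<i> / of_real (sqrt 2)) * snd h)) (at p)"
    by (simp add: case_prod_unfold algebra_simps add_divide_distrib)
  then show "\<exists>a b. ((\<lambda>(z, w). f ((z + \<i> * w) / of_real (sqrt 2))) has_derivative
      (\<lambda>h. a * fst h + b * snd h)) (at p)"
    by blast
qed

text \<open>Conjugating \<open>z\<close> exchanges \<open>A\<close> and \<open>B\<close>, which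
  fixes \<open>S\<close> and negates \<open>T\<close>. The parallelogram law is applied to
  \<open>S\<close>, \<open>T\<close> and again to \<open>A\<close>, \<open>B\<close>, left
  multiplication by \<open>I * i\<close> being isometric.\<close>

lemma Ext_conjugate_parallelogram:
  assumes i: "i \<in> imag_units" and I: "I \<in> imag_units"
  shows "(norm (Ext i f (emb I z)))\<^sup>2 + (norm (Ext i f (emb I (cnj z))))\<^sup>2
    = (norm (f z))\<^sup>2 + (norm (f (cnj z)))\<^sup>2"
proof -
  define A B where "A = emb i (f z)" and "B = emb i (f (cnj z))"
  define S T where "S = (1/2) *\<^sub>R (A + B)" and "T = (1/2) *\<^sub>R (I * i * (B - A))"
  have par: "(norm (x + y))\<^sup>2 + (norm (x - y))\<^sup>2 = 2 * (norm x)\<^sup>2 + 2 * (norm y)\<^sup>2" for x y :: quat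
    unfolding power2_norm_eq_inner by (simp add: inner_simps)
  have minus: "I * i * (A - B) = - (I * i * (B - A))"
    by (simp add: right_diff_distrib)
  have "Ext i f (emb I z) = S + T" "Ext i f (emb I (cnj z)) = S - T"
    by (simp_all add: Ext_emb[OF I] S_def T_def minus add.commute flip: A_def B_def)
  then have "(norm (Ext i f (emb I z)))\<^sup>2 + (norm (Ext i f (emb I (cnj z))))\<^sup>2
      = 2 * (norm S)\<^sup>2 + 2 * (norm T)\<^sup>2"
    by (simp add: par)
  also have "\<dots> = ((norm (A + B))\<^sup>2 + (norm (A - B))\<^sup>2) / 2"
    by (simp add: S_def T_def norm_mult imag_units_norm i I norm_minus_commute power_mult_distrib
        power_divide)
  also have "\<dots> = (norm (f z))\<^sup>2 + (norm (f (cnj z)))\<^sup>2"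
    by (simp add: par A_def B_def norm_emb i)
  finally show ?thesis .
qed

text \<open>The parallelogram identity dominates the integrand for \<open>f\<close> by
  \<open>u\<close> at \<open>z\<close> plus \<open>u\<close> at \<open>cnj z\<close>, and
  conjugation preserves Lebesgue measure.\<close>

lemma Ext_integrable_imp_integrable:
  assumes i: "i \<in> imag_units" and I: "I \<in> imag_units" and f: "continuous_on UNIV f"
    and int: "integrable lborel (\<lambda>z. (norm (Ext i f (emb I z)))\<^sup>2 * exp (- \<nu> * (norm z)\<^sup>2))"
  shows "integrable lborel (\<lambda>z. (norm (f z))\<^sup>2 * exp (- \<nu> * (norm z)\<^sup>2))"
proof -
  have [measurable]: "f \<in> borel_measurable borel"
    by (rule borel_measurable_continuous_onI[OF f])
  define u where "u z = (norm (Ext i f (emb I z)))\<^sup>2 * exp (- \<nu> * (norm z)\<^sup>2)" for z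
  have u: "integrable lborel u"
    using int by (simp add: u_def[abs_def])
  then have [measurable]: "u \<in> borel_measurable borel"
    by auto
  have [measurable]: "cnj \<in> borel \<rightarrow>\<^sub>M borel"
    by (intro borel_measurable_continuous_onI continuous_intros)
  have "(\<integral>\<^sup>+z. ennreal (norm (u (cnj z))) \<partial>lborel) = (\<integral>\<^sup>+z. ennreal (norm (u z)) \<partial>lborel)"
    by (rule nn_integral_complex_cnj[where g = "\<lambda>z. ennreal (norm (u z))"]) measurable
  then have "integrable lborel (\<lambda>z. u (cnj z))"
    using u by (simp add: integrable_iff_bounded)
  then have "integrable lborel (\<lambda>z. u z + u (cnj z))"
    using u by simp
  then show ?thesis
  proof (rule Bochner_Integration.integrable_bound)
    have "(norm (f z))\<^sup>2 * exp (- \<nu> * (norm z)\<^sup>2) \<le> u z + u (cnj z)" for z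
    proof -
      have "(norm (f z))\<^sup>2 \<le> (norm (Ext i f (emb I z)))\<^sup>2 + (norm (Ext i f (emb I (cnj z))))\<^sup>2"
        by (simp add: Ext_conjugate_parallelogram[OF i I])
      then have "(norm (f z))\<^sup>2 * exp (- \<nu> * (norm z)\<^sup>2)
        \<le> ((norm (Ext i f (emb I z)))\<^sup>2 + (norm (Ext i f (emb I (cnj z))))\<^sup>2) * exp (- \<nu> * (norm z)\<^sup>2)"
        by (rule mult_right_mono) simp
      then show ?thesis by (simp add: u_def algebra_simps)
    qed
    moreover have "0 \<le> u z" for z by (simp add: u_def)
    ultimately show "AE z in lborel. norm ((norm (f z))\<^sup>2 * exp (- \<nu> * (norm z)\<^sup>2)) \<le> norm (u z + u (cnj z))"
      by simp
  qed measurable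
qed

lemma Ext_mem_fock_slice_preserving:
  assumes i: "i \<in> imag_units" and f: "f holomorphic_on UNIV"
    and int: "integrable lborel (\<lambda>z. (norm (f z))\<^sup>2 * exp (- \<nu> * (norm z)\<^sup>2))"
  shows "Ext i f \<in> fock_slice_preserving i \<nu>"
  using assms
  by (auto simp: fock_slice_preserving_def fock_slice_def slice_regular_Ext slice_eq_range_emb
      Ext_emb_self norm_emb intro!: bexI[of _ i])

text \<open>Preservation of the slice makes \<open>G\<close> on it a complex function
  \<open>f\<close>. Agreement on the real axis then forces \<open>G = Ext i f\<close>, and
  integrability passes from the unknown slice of the definition to \<open>f\<close>.\<close>

lemma fock_slice_preserving_Ext:
  assumes i: "i \<in> imag_units" and G: "G \<in> fock_slice_preserving i \<nu>"
  obtains f where "f holomorphic_on UNIV" "G = Ext i f"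
    "integrable lborel (\<lambda>z. (norm (f z))\<^sup>2 * exp (- \<nu> * (norm z)\<^sup>2))"
proof
  define f where "f z = slice_coord i 1 (G (emb i z))" for z
  have reg: "slice_regular G" and sub: "G ` slice i \<subseteq> slice i"
    using G by (auto simp: fock_slice_preserving_def fock_slice_def)
  show f: "f holomorphic_on UNIV"
    unfolding f_def by (rule slice_regular_coord_holomorphic[OF reg i])
  have "emb i (f z) = G (emb i z)" for z
  proof -
    have "G (emb i z) \<in> range (emb i)"
      using sub by (auto simp: slice_eq_range_emb)
    then show ?thesis by (auto simp: f_def slice_coord_emb i)
  qed
  then have "G (of_real x) = Ext i f (of_real x)" for x
    using Ext_emb_self[OF i, of f "of_real x"] by (metis emb_of_real)
  then show eq: "G = Ext i f"
    by (rule slice_regular_eqI[OF reg slice_regular_Ext[OF i f]])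
  obtain I where "I \<in> imag_units"
    and "integrable lborel (\<lambda>z. (norm (G (emb I z)))\<^sup>2 * exp (- \<nu> * (norm (emb I z))\<^sup>2))"
    using G by (auto simp: fock_slice_preserving_def fock_slice_def)
  then show "integrable lborel (\<lambda>z. (norm (f z))\<^sup>2 * exp (- \<nu> * (norm z)\<^sup>2))"
    using Ext_integrable_imp_integrable[OF i _ holomorphic_on_imp_continuous_on[OF f]]
    by (simp add: eq norm_emb)
qed

lemma slice_transform_kernel2:
  assumes i: "i \<in> imag_units"
  shows "slice_transform i (\<lambda>p. kernel2 \<nu> p (z, w)) q
    = (\<nu> / pi) *\<^sub>R kernel_quat \<nu> q (emb i ((z + \<i> * w) / of_real (sqrt 2)))"
proof -
  define p where "p = (z + \<i> * w) / of_real (sqrt 2)"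
  define a where "a n = of_real ((\<nu> / pi)\<^sup>2) * ((of_real \<nu> * cnj p) ^ n / fact n)" for n
  define f where "f = (\<lambda>p. kernel2 \<nu> p (z, w)) \<circ> psi2"
  have f_sums: "(\<lambda>n. a n * \<xi> ^ n) sums f \<xi>" for \<xi>
  proof -
    \<comment> \<open>The factor \<open>- \<i>\<close> in \<open>psi2\<close> joins
      \<open>cnj z\<close> and \<open>cnj w\<close> into the conjugate of
      \<open>z + \<i> * w\<close>.\<close>
    have "f \<xi> = of_real ((\<nu> / pi)\<^sup>2) * exp (of_real \<nu> * cnj p * \<xi>)"
      by (simp add: f_def kernel2_def psi2_def p_def algebra_simps add_divide_distrib diff_divide_distrib)
    moreover have "(\<lambda>n. of_real ((\<nu> / pi)\<^sup>2) * ((of_real \<nu> * cnj p * \<xi>) ^ n /\<^sub>R fact n))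
        sums (of_real ((\<nu> / pi)\<^sup>2) * exp (of_real \<nu> * cnj p * \<xi>))"
      by (intro sums_mult exp_converges)
    moreover have "of_real ((\<nu> / pi)\<^sup>2) * ((of_real \<nu> * cnj p * \<xi>) ^ n /\<^sub>R fact n) = a n * \<xi> ^ n" for n
      by (simp add: a_def scaleR_conv_of_real power_mult_distrib divide_inverse mult_ac)
    ultimately show ?thesis by simp
  qed
  \<comment> \<open>One factor \<open>\<nu> / pi\<close> belongs to the quaternionic kernel, the
    other stays in front of it.\<close>
  have "emb i (a n) = (\<nu> / pi) *\<^sub>R (\<nu> / pi) *\<^sub>R (\<nu> ^ n / fact n) *\<^sub>R qcnj (emb i p) ^ n" for n
  proof -
    have "a n = ((\<nu> / pi) * (\<nu> / pi) * (\<nu> ^ n / fact n)) *\<^sub>R cnj p ^ n"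
      by (simp add: a_def scaleR_conv_of_real power2_eq_square power_mult_distrib divide_inverse mult_ac)
    then show ?thesis
      by (simp add: emb_scaleR emb_power emb_cnj i mult.assoc)
  qed
  then have "(\<lambda>n. (\<nu> / pi) *\<^sub>R (\<nu> / pi) *\<^sub>R ((\<nu> ^ n / fact n) *\<^sub>R (q ^ n * qcnj (emb i p) ^ n))) sums Ext i f q"
    using Ext_sums[OF i f_sums, of q] by simp
  moreover have "(\<lambda>n. (\<nu> / pi) *\<^sub>R (\<nu> / pi) *\<^sub>R ((\<nu> ^ n / fact n) *\<^sub>R (q ^ n * qcnj (emb i p) ^ n)))
      sums ((\<nu> / pi) *\<^sub>R kernel_quat \<nu> q (emb i p))"
    unfolding kernel_quat_def
    by (intro sums_scaleR_right summable_sums kernel_quat_summable)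
  ultimately show ?thesis
    unfolding slice_transform_def f_def[symmetric] p_def[symmetric] by (rule sums_unique2)
qed

theorem theorem3p4:
  fixes \<nu> :: real and i :: quat
  assumes "\<nu> > 0" and "i \<in> imag_units"
  shows "slice_transform i ` fock2 \<nu> = fock_slice_preserving i \<nu> \<and>
    (\<forall>z w q. slice_transform i (\<lambda>p. kernel2 \<nu> p (z, w)) q =
       (\<nu> / pi) *\<^sub>R kernel_quat \<nu> q (emb i ((z + \<i> * w) / of_real (sqrt 2))))"
proof (intro conjI allI equalityI subsetI)
  fix G assume "G \<in> slice_transform i ` fock2 \<nu>"
  then obtain F where F: "holomorphic2 F" and G: "G = Ext i (F \<circ> psi2)"
    and int: "integrable lborel
      (\<lambda>(z, w). (norm (F (z, w)))\<^sup>2 * exp (- \<nu> * ((norm z)\<^sup>2 + (norm w)\<^sup>2)))"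
    by (auto simp: fock2_def slice_transform_def)
  have "(\<lambda>w. F (z, w)) holomorphic_on UNIV" for z
    using holomorphic2_along_line[OF F, of z 0 0 1] by simp
  from fock2_restrict_psi2[OF holomorphic2_continuous[OF F] this int]
  show "G \<in> fock_slice_preserving i \<nu>"
    unfolding G by (intro Ext_mem_fock_slice_preserving assms holomorphic2_psi2 F) simp
next
  fix G assume "G \<in> fock_slice_preserving i \<nu>"
  with assms(2) obtain f where f: "f holomorphic_on UNIV" and G: "G = Ext i f"
    and int: "integrable lborel (\<lambda>z. (norm (f z))\<^sup>2 * exp (- \<nu> * (norm z)\<^sup>2))"
    by (rule fock_slice_preserving_Ext)
  \<comment> \<open>Along \<open>psi2\<close> the two summands of \<open>z + \<i> * w\<close>
    coincide, which gives \<open>F \<circ> psi2 = f\<close>.\<close>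
  define F where "F = (\<lambda>(z, w). f ((z + \<i> * w) / of_real (sqrt 2)))"
  have "F \<in> fock2 \<nu>"
    using holomorphic2_lift[OF f] fock2_lift[OF assms(1) holomorphic_on_imp_continuous_on[OF f] int]
    by (simp add: fock2_def F_def)
  moreover have "F \<circ> psi2 = f"
  proof
    fix \<xi> :: complex
    have "of_real (sqrt 2) * of_real (sqrt 2) = (2 :: complex)"
      by (simp flip: of_real_mult)
    then show "(F \<circ> psi2) \<xi> = f \<xi>"
      by (simp add: F_def psi2_def add_divide_distrib[symmetric] mult.assoc[symmetric])
  qed
  ultimately show "G \<in> slice_transform i ` fock2 \<nu>"
    by (auto simp: G slice_transform_def image_iff intro!: bexI[of _ F])
qed (rule slice_transform_kernel2[OF assms(2)])

end
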